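(* Let $\mathbb{X}$ be a finite set of points in $\mathbb{P}^{n_1}\times\cdots\times\mathbb{P}^{n_k}$ with defining ideal $I_{\mathbb{X}}$, and set $\mathcal{E}=\mathcal{B}\setminus\mathcal{A}$, where $\mathcal{A},\mathcal{B}\subseteq\mathbb{N}^k$ are the sets determined by the Hilbert function $H_{\mathbb{X}}$ as defined in the context. Then $\mathcal{E}$ is a finite set. Furthermore, if $f$ is a generator of $I_{\mathbb{X}}$, then $\deg f\in\mathcal{E}$. In particular, $$I_{\mathbb{X}}=\Big\langle \bigoplus_{\underline{i}\in\mathcal{E}}(I_{\mathbb{X}})_{\underline{i}}\Big\rangle .$$
   Context: $\mathbf{k}$ is an algebraically closed field of characteristic $0$; $\mathbb{N}=\{0,1,2,\ldots\}$, $\mathbb{N}^+=\{1,2,\ldots\}$; $k\ge 1$ and $n_1,\ldots,n_k\ge 1$ are integers; $[k]=\{1,\ldots,k\}$; $e_1,\ldots,e_k$ is the standard basis of $\mathbb{N}^k$. $R=\mathbf{k}[x_{l,m} : 1\le l\le k,\ 0\le m\le n_l]$ is $\mathbb{N}^k$-graded by $\deg x_{l,m}=e_l$; it is the coordinate ring of $\mathbb{P}^{n_1}\times\cdots\times\mathbb{P}^{n_k}$ over $\mathbf{k}$. For a nonempty finite set $\mathbb{X}$ of points, $I_{\mathbb{X}}\subseteq R$ is the ideal generated by the $\mathbb{N}^k$-homogeneous forms vanishing at every point of $\mathbb{X}$, and $H_{\mathbb{X}}(\underline{i})=\dim_{\mathbf{k}}(R/I_{\mathbb{X}})_{\underline{i}}$.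 A generator of $I_{\mathbb{X}}$ means a minimal homogeneous generator, i.e. a homogeneous $f\in(I_{\mathbb{X}})_{\underline{j}}$ (some $\underline{j}$) not belonging to $\sum_{m=1}^kR_{e_m}(I_{\mathbb{X}})_{\underline{j}-e_m}$, where $R_{e_m}(I_{\mathbb{X}})_{\underline{i}}=\{f_0x_{m,0}+\cdots+f_{n_m}x_{m,n_m}\mid f_h\in (I_{\mathbb{X}})_{\underline{i}}\}$ (and is $0$ if $\underline{i}\notin\mathbb{N}^k$). Set $\mathcal{B}=\{\underline{i}\in\mathbb{N}^k\mid H_{\mathbb{X}}(\underline{i})<\dim_{\mathbf{k}}R_{\underline{i}}\}=\{\underline{i}\in\mathbb{N}^k\mid (I_{\mathbb{X}})_{\underline{i}}\ne 0\}$. For $l\in[k]$ and $\underline{j}=(j_1,\ldots,j_{l-1},j_{l+1},\ldots,j_k)\in\mathbb{N}^{k-1}$ let $$i(\underline{j})=\min\{\,i\in\mathbb{N}^+ \mid H_{\mathbb{X}}(j_1,\ldots,j_{l-1},i-1,j_{l+1},\ldots,j_k)=H_{\mathbb{X}}(j_1,\ldots,j_{l-1},i,j_{l+1},\ldots,j_k)\,\}$$ (this exists; it depends on $l$ as well as $\underline{j}$), let $$\mathcal{A}_{l,\underline{j}}=\{(j_1,\ldots,j_{l-1},i(\underline{j}),j_{l+1},\ldots,j_k)+re_l\mid r\in\mathbb{N}^+\},$$ and set $\mathcal{A}=\bigcup_{l=1}^k\bigcup_{\underline{j}\in\mathbb{N}^{k-1}}\mathcal{A}_{l,\underline{j}}$.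 *)

theory Defs
  imports
    "HOL-Library.Poly_Mapping"
    "HOL-Library.FuncSet"
    "HOL-Algebra.Embedded_Algebras"
    "HOL-Algebra.QuotRing"
    "HOL-Algebra.Algebraic_Closure_Type"
begin

section \<open>The multigraded coordinate ring\<close>

text \<open>
  Polynomials are finitely supported maps from monomials to coefficients, and monomials are
  finitely supported maps from variables to exponents. The pair \<open>(l, m)\<close> stands for the
  variable $x_{l,m}$.
\<close>

type_synonym monom = "nat \<times> nat \<Rightarrow>\<^sub>0 nat"
type_synonym 'a mpoly = "monom \<Rightarrow>\<^sub>0 'a"
type_synonym multideg = "nat \<Rightarrow>\<^sub>0 nat"

text \<open>
  Multi-indices with index set \<open>L\<close>: \<open>multidegs {1..k}\<close> is $\mathbb{N}^k$, and
  \<open>multidegs ({1..k} - {l})\<close> is the $\mathbb{N}^{k-1}$ obtained by omitting the \<open>l\<close>-th entry.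
\<close>

definition multidegs :: "nat set \<Rightarrow> multideg set" where
  "multidegs L = {i. Poly_Mapping.keys i \<subseteq> L}"

abbreviation unit_deg :: "nat \<Rightarrow> multideg" where
  "unit_deg l \<equiv> Poly_Mapping.single l 1"

definition mvars :: "nat \<Rightarrow> (nat \<Rightarrow> nat) \<Rightarrow> (nat \<times> nat) set" where
  "mvars k n = (SIGMA l:{1..k}. {0..n l})"

definition mvar :: "nat \<Rightarrow> nat \<Rightarrow> 'a::comm_ring_1 mpoly" where
  "mvar l m = Poly_Mapping.single (Poly_Mapping.single (l, m) 1) 1"

definition mpoly_ring :: "nat \<Rightarrow> (nat \<Rightarrow> nat) \<Rightarrow> 'a::comm_ring_1 mpoly ring" where
  "mpoly_ring k n =
     ring_of_type_algebra \<lparr>carrier := {p. \<forall>\<mu>\<in>Poly_Mapping.keys p. Poly_Mapping.keys \<mu> \<subseteq> mvars k n}\<rparr>"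

definition const_polys :: "'a::comm_ring_1 mpoly set" where
  "const_polys = range (Poly_Mapping.single 0)"

definition monom_deg :: "monom \<Rightarrow> multideg" where
  "monom_deg \<mu> =
     (\<Sum>v\<in>Poly_Mapping.keys \<mu>. Poly_Mapping.single (fst v) (Poly_Mapping.lookup \<mu> v))"

definition forms :: "nat \<Rightarrow> (nat \<Rightarrow> nat) \<Rightarrow> multideg \<Rightarrow> 'a::comm_ring_1 mpoly set" where
  "forms k n i =
     {p \<in> carrier (mpoly_ring k n). \<forall>\<mu>\<in>Poly_Mapping.keys p. monom_deg \<mu> = i}"

definition peval :: "'a::comm_ring_1 mpoly \<Rightarrow> (nat \<Rightarrow> nat \<Rightarrow> 'a) \<Rightarrow> 'a" where
  "peval p a = (\<Sum>\<mu>\<in>Poly_Mapping.keys p. Poly_Mapping.lookup p \<mu> *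
     (\<Prod>(l, m)\<in>Poly_Mapping.keys \<mu>. a l m ^ Poly_Mapping.lookup \<mu> (l, m)))"

section \<open>Points of a product of projective spaces\<close>

text \<open>
  A vector of \<open>N + 1\<close> coordinates is a function that vanishes beyond index \<open>N\<close>; a point of
  projective \<open>N\<close>-space is a class of nonzero vectors modulo nonzero scalars.
\<close>

definition proj_space :: "nat \<Rightarrow> (nat \<Rightarrow> 'a::field) set set" where
  "proj_space N =
     {a. (\<exists>m\<le>N. a m \<noteq> 0) \<and> (\<forall>m>N. a m = 0)} // {(a, b). \<exists>c. c \<noteq> 0 \<and> (\<forall>m. b m = c * a m)}"

definition multiproj_space ::
    "nat \<Rightarrow> (nat \<Rightarrow> nat) \<Rightarrow> (nat \<Rightarrow> (nat \<Rightarrow> 'a::field) set) set" where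
  "multiproj_space k n = (\<Pi>\<^sub>E l\<in>{1..k}. proj_space (n l))"

text \<open>
  Vanishing is required for every choice of representatives; for a form this does not depend
  on the choice.
\<close>

definition vanishes_at ::
    "nat \<Rightarrow> 'a::field mpoly \<Rightarrow> (nat \<Rightarrow> (nat \<Rightarrow> 'a) set) \<Rightarrow> bool" where
  "vanishes_at k p P \<longleftrightarrow> (\<forall>a. (\<forall>l\<in>{1..k}. a l \<in> P l) \<longrightarrow> peval p a = 0)"

section \<open>The defining ideal and its Hilbert function\<close>

definition point_ideal ::
    "nat \<Rightarrow> (nat \<Rightarrow> nat) \<Rightarrow> (nat \<Rightarrow> (nat \<Rightarrow> 'a::field) set) set \<Rightarrow> 'a mpoly set" where
  "point_ideal k n \<X> =
     Idl\<^bsub>mpoly_ring k n\<^esub> {p. \<exists>i\<in>multidegs {1..k}. p \<in> forms k n i \<and> (\<forall>P\<in>\<X>. vanishes_at k p P)}"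

definition point_ideal_deg ::
    "nat \<Rightarrow> (nat \<Rightarrow> nat) \<Rightarrow> (nat \<Rightarrow> (nat \<Rightarrow> 'a::field) set) set \<Rightarrow> multideg \<Rightarrow> 'a mpoly set" where
  "point_ideal_deg k n \<X> i = point_ideal k n \<X> \<inter> forms k n i"

text \<open>
  The graded piece $(R/I)_i$ is the image of $R_i$ in the quotient ring, and its dimension is
  taken over the image of the field of constants.
\<close>

definition hilbert_fun ::
    "nat \<Rightarrow> (nat \<Rightarrow> nat) \<Rightarrow> (nat \<Rightarrow> (nat \<Rightarrow> 'a::field) set) set \<Rightarrow> multideg \<Rightarrow> nat" where
  "hilbert_fun k n \<X> i =
     (let R = mpoly_ring k n; I = point_ideal k n \<X>; cls = (\<lambda>p. I +>\<^bsub>R\<^esub> p)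
      in ring.dim (R Quot I) (cls ` const_polys) (cls ` forms k n i))"

section \<open>Minimal generators\<close>

text \<open>
  The set $R_{e_m}(I_X)_{j-e_m}$. The case distinction is needed because subtraction of
  multi-indices is truncated.
\<close>

definition var_mult_piece ::
    "nat \<Rightarrow> (nat \<Rightarrow> nat) \<Rightarrow> (nat \<Rightarrow> (nat \<Rightarrow> 'a::field) set) set \<Rightarrow> multideg \<Rightarrow> nat \<Rightarrow> 'a mpoly set" where
  "var_mult_piece k n \<X> j m =
     (if Poly_Mapping.lookup j m = 0 then {0}
      else {\<Sum>h=0..n m. f h * mvar m h | f. \<forall>h\<in>{0..n m}. f h \<in> point_ideal_deg k n \<X> (j - unit_deg m)})"

definition is_generator ::
    "nat \<Rightarrow> (nat \<Rightarrow> nat) \<Rightarrow> (nat \<Rightarrow> (nat \<Rightarrow> 'a::field) set) set \<Rightarrow> multideg \<Rightarrow> 'a mpoly \<Rightarrow> bool" where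
  "is_generator k n \<X> j f \<longleftrightarrow>
     j \<in> multidegs {1..k} \<and> f \<in> point_ideal_deg k n \<X> j \<and>
     f \<notin> {\<Sum>m=1..k. g m | g. \<forall>m\<in>{1..k}. g m \<in> var_mult_piece k n \<X> j m}"

section \<open>The sets of multidegrees\<close>

definition calB ::
    "nat \<Rightarrow> (nat \<Rightarrow> nat) \<Rightarrow> (nat \<Rightarrow> (nat \<Rightarrow> 'a::field) set) set \<Rightarrow> multideg set" where
  "calB k n \<X> =
     {i \<in> multidegs {1..k}.
        hilbert_fun k n \<X> i
          < ring.dim (mpoly_ring k n) (const_polys :: 'a mpoly set) (forms k n i)}"

text \<open>
  Adding \<open>Poly_Mapping.single l i\<close> to an index \<open>j\<close> without \<open>l\<close>-th entry inserts \<open>i\<close> there.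
\<close>

definition stable_index ::
    "nat \<Rightarrow> (nat \<Rightarrow> nat) \<Rightarrow> (nat \<Rightarrow> (nat \<Rightarrow> 'a::field) set) set \<Rightarrow> nat \<Rightarrow> multideg \<Rightarrow> nat" where
  "stable_index k n \<X> l j =
     (LEAST i. 1 \<le> i \<and>
        hilbert_fun k n \<X> (j + Poly_Mapping.single l (i - 1))
          = hilbert_fun k n \<X> (j + Poly_Mapping.single l i))"

definition calA_part ::
    "nat \<Rightarrow> (nat \<Rightarrow> nat) \<Rightarrow> (nat \<Rightarrow> (nat \<Rightarrow> 'a::field) set) set \<Rightarrow> nat \<Rightarrow> multideg \<Rightarrow> multideg set" where
  "calA_part k n \<X> l j =
     {j + Poly_Mapping.single l (stable_index k n \<X> l j) + Poly_Mapping.single l r | r. 1 \<le> r}"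

definition calA ::
    "nat \<Rightarrow> (nat \<Rightarrow> nat) \<Rightarrow> (nat \<Rightarrow> (nat \<Rightarrow> 'a::field) set) set \<Rightarrow> multideg set" where
  "calA k n \<X> = (\<Union>l\<in>{1..k}. \<Union>j\<in>multidegs ({1..k} - {l}). calA_part k n \<X> l j)"

definition calE ::
    "nat \<Rightarrow> (nat \<Rightarrow> nat) \<Rightarrow> (nat \<Rightarrow> (nat \<Rightarrow> 'a::field) set) set \<Rightarrow> multideg set" where
  "calE k n \<X> = calB k n \<X> - calA k n \<X>"

text \<open>
  The sum of the graded pieces of the ideal over a possibly infinite set \<open>D\<close> of multidegrees.
  As a subspace of the graded ring it is automatically direct.
\<close>

definition point_ideal_sum ::
    "nat \<Rightarrow> (nat \<Rightarrow> nat) \<Rightarrow> (nat \<Rightarrow> (nat \<Rightarrow> 'a::field) set) set \<Rightarrow> multideg set \<Rightarrow> 'a mpoly set" where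
  "point_ideal_sum k n \<X> D =
     {\<Sum>i\<in>F. f i | F f. finite F \<and> F \<subseteq> D \<and> (\<forall>i\<in>F. f i \<in> point_ideal_deg k n \<X> i)}"

end

(*
  Evaluation at chosen representatives identifies (R/I)_i with a subspace V i of the functions on
  the points, so the Hilbert function is dim (V i) <= |X|. A linear form L of degree e_l that
  vanishes at no point maps V d injectively into V (d + e_l); hence the Hilbert function grows
  strictly in direction l until it stabilises after at most |X| + 1 steps, which confines calE to a
  finite box. If the dimensions of V d and V (d + e_l) agree, then V (d + e_l) = L V d, an equality
  that persists in direction l. Given a form f = sum_m x_{l,m} g_m of degree d + 2 e_l in the ideal,
  write g_m = L h_m + u_m with u_m in the ideal; then L w, and therefore w = sum_m x_{l,m} h_m, lies
  in the ideal, so f = L w + sum_m x_{l,m} u_m is not a minimal generator.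
*)
theory Submission
  imports Defs "HOL-Library.Function_Algebras"
begin

section \<open>Dimension of subspaces\<close>

text \<open>The overview leaves open where L comes from. In characteristic 0 the field is infinite,
  and with coefficients 1, t, t^2, ... the value of L at a point is a nonzero univariate polynomial
  in t, so some t avoids all zeros at once. The condition \<open>1 \<le> r\<close> in
  \<open>calA_part\<close> matches the reduction: if s is the stable index, equal dimensions at s -
  1 and s make multiplication by L onto in degree s. This controls the coefficients of forms one
  degree higher, so generators are excluded from s + 1 on. Membership in \<open>calB\<close> is a
  separate matter: a generator is nonzero, hence a nontrivial kernel vector of evaluation in its
  degree, and the dimension drops. The ideal equality comes by induction on the total degree, since
  a non-generator is a combination of variables times ideal elements of lower degree. A formal
  obstacle is that \<open>ring.dim\<close> measures a subset of a ring over a subfield, while linear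
  maps and subspaces are handled with \<open>vector_space.dim\<close>; the two have to be
  connected.\<close>

lemma (in ring) dimension_image_span:
  fixes scale :: "'k::field \<Rightarrow> 'v::ab_group_add \<Rightarrow> 'v" and \<phi> :: "'k \<Rightarrow> 'a"
  assumes "vector_space scale" and "finite B" and "\<not> module.dependent scale B"
    and "\<And>x. x \<in> module.span scale B \<Longrightarrow> g x \<in> carrier R"
    and "\<And>x y. x \<in> module.span scale B \<Longrightarrow> y \<in> module.span scale B \<Longrightarrow> g (x + y) = g x \<oplus> g y"
    and "\<And>c x. x \<in> module.span scale B \<Longrightarrow> g (scale c x) = \<phi> c \<otimes> g x"
    and "inj_on g (module.span scale B)"
  shows "dimension (card B) (range \<phi>) (g ` module.span scale B)"
proof -
  interpret V: vector_space scale by fact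
  show ?thesis
    using assms(2-)
  \<comment> \<open>Induction on the basis follows the inductive definition of
    \<open>dimension\<close>: a new independent vector contributes exactly one
    \<open>line_extension\<close>, and injectivity of \<open>g\<close> keeps its image outside the
    image of the smaller span.\<close>
  proof (induction B rule: finite_induct)
    case empty
    have "g 0 = g 0 \<oplus> g 0" "g 0 \<in> carrier R"
      using empty.prems(2)[of 0] empty.prems(3)[of 0 0] by auto
    then have "g 0 = \<zero>"
      by (metis r_right_minus_eq a_minus_def add.m_assoc add.inv_closed r_neg r_zero)
    then show ?case
      using zero_dim by auto
  next
    case (insert b B)
    have sub: "V.span B \<subseteq> V.span (insert b B)"
      by (rule V.span_mono) auto
    have b: "b \<in> V.span (insert b B)"
      by (rule V.span_base) auto
    have nb: "b \<notin> V.span B" "V.independent B"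
      using insert.prems(1) insert.hyps(2) by (auto simp: V.independent_insert)
    have IH: "dimension (card B) (range \<phi>) (g ` V.span B)"
      using insert.prems(2-) nb(2) subsetD[OF sub] sub
      by (intro insert.IH) (auto intro: inj_on_subset)
    have "g b \<notin> g ` V.span B"
      using insert.prems(5) b nb(1) sub by (auto simp: inj_on_def)
    then have "dimension (Suc (card B)) (range \<phi>) (line_extension (range \<phi>) (g b) (g ` V.span B))"
      using IH insert.prems(2)[OF b] by (intro Suc_dim) auto
    moreover have "line_extension (range \<phi>) (g b) (g ` V.span B) = g ` V.span (insert b B)"
    proof -
      have comb: "g (scale c b + y) = \<phi> c \<otimes> g b \<oplus> g y" if "y \<in> V.span B" for c y
        using insert.prems(3)[of "scale c b" y] insert.prems(4)[OF b] sub that V.span_scale[OF b]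
        by auto
      have "u \<in> line_extension (range \<phi>) (g b) (g ` V.span B) \<longleftrightarrow> u \<in> g ` V.span (insert b B)" for u
      proof
        assume "u \<in> line_extension (range \<phi>) (g b) (g ` V.span B)"
        then obtain c y where "y \<in> V.span B" "u = g (scale c b + y)"
          by (auto simp: line_extension_mem_iff comb)
        moreover from this have "scale c b + y \<in> V.span (insert b B)"
          using sub b by (auto intro: V.span_add V.span_scale)
        ultimately show "u \<in> g ` V.span (insert b B)"
          by blast
      next
        assume "u \<in> g ` V.span (insert b B)"
        then obtain x c where x: "u = g x" "x - scale c b \<in> V.span B"
          using V.span_breakdown_eq by blast
        then have "u = \<phi> c \<otimes> g b \<oplus> g (x - scale c b)"
          using comb[OF x(2), of c] by simp
        with x(2) show "u \<in> line_extension (range \<phi>) (g b) (g ` V.span B)"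
          by (auto simp: line_extension_mem_iff)
      qed
      then show ?thesis by blast
    qed
    ultimately show ?case
      using insert.hyps by simp
  qed
qed

text \<open>The bridge between the two notions of dimension. It serves twice: with the identity on
  forms, and with the map from value vectors to residue classes. The finite set \<open>T\<close>
  makes a basis of \<open>U\<close> finite, so that its cardinality is a true dimension.\<close>

lemma (in ring) dim_image_subspace:
  fixes scale :: "'k::field \<Rightarrow> 'v::ab_group_add \<Rightarrow> 'v" and \<phi> :: "'k \<Rightarrow> 'a"
  assumes "vector_space scale" and "module.subspace scale U"
    and "finite T" and "U \<subseteq> module.span scale T" and "subfield (range \<phi>) R"
    and "\<And>x. x \<in> U \<Longrightarrow> g x \<in> carrier R"
    and "\<And>x y. x \<in> U \<Longrightarrow> y \<in> U \<Longrightarrow> g (x + y) = g x \<oplus> g y"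
    and "\<And>c x. x \<in> U \<Longrightarrow> g (scale c x) = \<phi> c \<otimes> g x"
    and "inj_on g U"
  shows "dim (range \<phi>) (g ` U) = vector_space.dim scale U"
proof -
  interpret V: vector_space scale by fact
  obtain B where B: "B \<subseteq> U" "V.independent B" "U \<subseteq> V.span B" "card B = V.dim U"
    using V.basis_exists by blast
  then have U: "V.span B = U"
    using assms(2) by (intro V.span_subspace)
  have "finite B"
    using V.independent_span_bound[OF assms(3) B(2)] B(1) assms(4) by auto
  then have "dimension (card B) (range \<phi>) (g ` U)"
    using dimension_image_span[OF assms(1) _ B(2), of g \<phi>] assms(6-9) U by simp
  then show ?thesis
    using dimI[OF assms(5)] B(4) by (simp add: over_def)
qed

text \<open>Extend the kernel vector \<open>x\<close> to a basis of \<open>U\<close>; the images of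
  the other basis vectors already span the image.\<close>

lemma (in vector_space) dim_linear_image_less:
  assumes "vector_space s2" and "Vector_Spaces.linear scale s2 f" and "subspace U"
    and "finite T" and "U \<subseteq> span T"
    and "x \<in> U" and "x \<noteq> 0" and "f x = 0"
  shows "vector_space.dim s2 (f ` U) < dim U"
proof -
  interpret W: vector_space s2 by fact
  interpret f: Vector_Spaces.linear scale s2 f by fact
  obtain B where B: "{x} \<subseteq> B" "B \<subseteq> U" "independent B" "U \<subseteq> span B"
    using maximal_independent_subset_extend[of "{x}" U] assms(6,7) by auto
  have fin: "finite B"
    using independent_span_bound[OF assms(4) B(3)] B(2) assms(5) by auto
  have "f ` U \<subseteq> W.span (f ` B)"
    using B(4) f.spans_image by blast
  also have "f ` B \<subseteq> insert 0 (f ` (B - {x}))"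
    using assms(8) by auto
  then have "W.span (f ` B) \<subseteq> W.span (f ` (B - {x}))"
    using W.span_mono W.span_insert_0 by metis
  finally have "W.dim (f ` U) \<le> card (f ` (B - {x}))"
    using fin by (intro W.dim_le_card) auto
  also have "\<dots> < card B"
    using B(1) fin card_image_le[of "B - {x}" f]
    by (metis card_Diff1_less finite_Diff insert_subset le_less_trans)
  also have "card B = dim U"
    using B by (intro basis_card_eq_dim)
  finally show ?thesis .
qed

text \<open>A vector of \<open>W\<close> outside \<open>U\<close> would enlarge a basis of
  \<open>U\<close> to an independent subset of \<open>W\<close> with more than \<open>dim W\<close>
  elements. The finite \<open>T\<close> appears because the ambient spaces of polynomials and of
  functions are infinite-dimensional.\<close>

lemma (in vector_space) subspace_eqI_dim:
  assumes "subspace U" and "subspace W" and "U \<subseteq> W" and "finite T" and "W \<subseteq> span T"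
    and "dim W \<le> dim U"
  shows "U = W"
proof (rule ccontr)
  assume "U \<noteq> W"
  then obtain w where w: "w \<in> W" "w \<notin> U"
    using assms(3) by blast
  obtain B where B: "B \<subseteq> U" "independent B" "U \<subseteq> span B" "card B = dim U"
    using basis_exists by blast
  have "w \<notin> span B"
    using B(1) assms(1) w(2) span_minimal by blast
  then have ind: "independent (insert w B)" and wB: "w \<notin> B"
    using B(2) by (auto simp: independent_insert intro: span_base)
  obtain C where C: "C \<subseteq> W" "independent C" "W \<subseteq> span C" "card C = dim W"
    using basis_exists by blast
  have finC: "finite C"
    using independent_span_bound[OF assms(4) C(2)] C(1) assms(5) by auto
  have "insert w B \<subseteq> span C"
    using B(1) w(1) assms(3) C(3) by blast
  then have "finite (insert w B) \<and> card (insert w B) \<le> card C"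
    by (rule independent_span_bound[OF finC ind])
  then show False
    using wB B(4) C(4) assms(6) by auto
qed

lemma (in vector_space) dim_subset_finite:
  assumes "U \<subseteq> W" and "finite T" and "W \<subseteq> span T"
  shows "dim U \<le> dim W"
proof -
  obtain C where C: "C \<subseteq> W" "independent C" "W \<subseteq> span C" "card C = dim W"
    using basis_exists by blast
  have "finite C"
    using independent_span_bound[OF assms(2) C(2)] C(1) assms(3) by auto
  then show ?thesis
    using dim_le_card[of U C] assms(1) C(3,4) by auto
qed

lemma (in vector_space) dim_injective_image:
  assumes "vector_space s2" and "Vector_Spaces.linear scale s2 f" and "subspace U"
    and "inj_on f U"
  shows "vector_space.dim s2 (f ` U) = dim U"
proof -
  interpret W: vector_space s2 by fact
  interpret f: Vector_Spaces.linear scale s2 f by fact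
  obtain B where B: "B \<subseteq> U" "independent B" "U \<subseteq> span B" "card B = dim U"
    using basis_exists by blast
  have U: "span B = U"
    using B assms(3) by (intro span_subspace)
  have "W.independent (f ` B)"
    using f.independent_injective_image[OF B(2)] assms(4) U by simp
  moreover have "f ` U = W.span (f ` B)"
    using f.span_image U by simp
  ultimately have "W.dim (f ` U) = card (f ` B)"
    by (simp add: W.dim_eq_card_independent)
  also have "\<dots> = card B"
    using B(1) assms(4) by (intro card_image) (auto intro: inj_on_subset)
  finally show ?thesis
    using B(4) by simp
qed

section \<open>Multigraded polynomials\<close>

definition monom_eval :: "monom \<Rightarrow> (nat \<Rightarrow> nat \<Rightarrow> 'a) \<Rightarrow> 'a::comm_ring_1" where
  "monom_eval \<mu> a = (\<Prod>v\<in>Poly_Mapping.keys \<mu>. a (fst v) (snd v) ^ Poly_Mapping.lookup \<mu> v)"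

text \<open>Summands have different supports; a common finite index set lets exponents be added
  factor by factor. \<open>peval_superset\<close> and \<open>monom_deg_superset\<close> serve the
  same purpose.\<close>

lemma monom_eval_superset:
  assumes "finite A" and "Poly_Mapping.keys \<mu> \<subseteq> A"
  shows "monom_eval \<mu> a = (\<Prod>v\<in>A. a (fst v) (snd v) ^ Poly_Mapping.lookup \<mu> v)"
  unfolding monom_eval_def using assms
  by (intro prod.mono_neutral_left) (auto simp: in_keys_iff)

lemma monom_eval_add: "monom_eval (\<mu> + \<nu>) a = monom_eval \<mu> a * monom_eval \<nu> a"
proof -
  let ?A = "Poly_Mapping.keys \<mu> \<union> Poly_Mapping.keys \<nu>"
  have "Poly_Mapping.keys (\<mu> + \<nu>) \<subseteq> ?A"
    by (rule Poly_Mapping.keys_add)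
  then show ?thesis
    by (simp add: monom_eval_superset[of ?A] lookup_add power_add prod.distrib)
qed

lemma monom_eval_0 [simp]: "monom_eval 0 a = 1"
  by (simp add: monom_eval_def)

lemma monom_eval_single [simp]: "monom_eval (Poly_Mapping.single (l, m) e) a = a l m ^ e"
  by (simp add: monom_eval_def)

lemma peval_superset:
  assumes "finite A" and "Poly_Mapping.keys p \<subseteq> A"
  shows "peval p a = (\<Sum>\<mu>\<in>A. Poly_Mapping.lookup p \<mu> * monom_eval \<mu> a)"
  unfolding peval_def monom_eval_def case_prod_unfold using assms
  by (intro sum.mono_neutral_cong_left) (auto simp: in_keys_iff)

lemma peval_add: "peval (p + q) a = peval p a + peval q a"
proof -
  let ?A = "Poly_Mapping.keys p \<union> Poly_Mapping.keys q"
  have "Poly_Mapping.keys (p + q) \<subseteq> ?A"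
    by (rule Poly_Mapping.keys_add)
  then show ?thesis
    by (simp add: peval_superset[of ?A] lookup_add algebra_simps sum.distrib)
qed

lemma peval_0 [simp]: "peval 0 a = 0"
  by (simp add: peval_def)

lemma peval_sum: "peval (\<Sum>x\<in>A. f x) a = (\<Sum>x\<in>A. peval (f x) a)"
  by (induction A rule: infinite_finite_induct) (auto simp: peval_add)

lemma peval_single: "peval (Poly_Mapping.single \<mu> c) a = c * monom_eval \<mu> a"
  by (subst peval_superset[of "{\<mu>}"]) auto

lemma poly_mapping_sum_single:
  "p = (\<Sum>\<mu>\<in>Poly_Mapping.keys p. Poly_Mapping.single \<mu> (Poly_Mapping.lookup p \<mu>))"
  by (rule poly_mapping_eqI)
    (auto simp: lookup_sum lookup_single when_def sum.delta in_keys_iff)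

lemma peval_mult: "peval (p * q) a = peval p a * peval q a"
proof -
  have "p * q = (\<Sum>\<mu>\<in>Poly_Mapping.keys p. \<Sum>\<nu>\<in>Poly_Mapping.keys q.
      Poly_Mapping.single (\<mu> + \<nu>) (Poly_Mapping.lookup p \<mu> * Poly_Mapping.lookup q \<nu>))"
    by (simp only: poly_mapping_sum_single[symmetric] flip: sum_product mult_single)
  then show ?thesis
    by (simp add: peval_sum peval_single monom_eval_add peval_superset[OF _ order_refl] sum_product
        algebra_simps)
qed

lemma peval_const [simp]: "peval (Poly_Mapping.single 0 c) a = c"
  by (simp add: peval_single)

lemma peval_mvar [simp]: "peval (mvar l m) a = a l m"
  by (simp add: mvar_def peval_single)

lemma monom_deg_superset:
  assumes "finite A" and "Poly_Mapping.keys \<mu> \<subseteq> A"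
  shows "monom_deg \<mu> = (\<Sum>v\<in>A. Poly_Mapping.single (fst v) (Poly_Mapping.lookup \<mu> v))"
  unfolding monom_deg_def using assms
  by (intro sum.mono_neutral_left) (auto simp: in_keys_iff)

lemma monom_deg_add: "monom_deg (\<mu> + \<nu>) = monom_deg \<mu> + monom_deg \<nu>"
proof -
  let ?A = "Poly_Mapping.keys \<mu> \<union> Poly_Mapping.keys \<nu>"
  have "Poly_Mapping.keys (\<mu> + \<nu>) \<subseteq> ?A"
    by (rule Poly_Mapping.keys_add)
  then show ?thesis
    by (simp add: monom_deg_superset[of ?A] lookup_add single_add sum.distrib)
qed

lemma monom_deg_0 [simp]: "monom_deg 0 = 0"
  by (simp add: monom_deg_def)

lemma monom_deg_single [simp]: "monom_deg (Poly_Mapping.single (l, m) e) = Poly_Mapping.single l e"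
  by (simp add: monom_deg_def)

lemma lookup_monom_deg_ge: "Poly_Mapping.lookup \<mu> v \<le> Poly_Mapping.lookup (monom_deg \<mu>) (fst v)"
proof (cases "v \<in> Poly_Mapping.keys \<mu>")
  case True
  have "Poly_Mapping.lookup \<mu> v \<le> (\<Sum>w\<in>Poly_Mapping.keys \<mu>.
      Poly_Mapping.lookup (Poly_Mapping.single (fst w) (Poly_Mapping.lookup \<mu> w)) (fst v))"
    using True by (subst sum.remove[of _ v]) auto
  then show ?thesis
    by (simp add: monom_deg_def lookup_sum)
qed (simp add: in_keys_iff)

lemma lookup_monom_deg_pos:
  assumes "0 < Poly_Mapping.lookup (monom_deg \<mu>) l"
  shows "\<exists>m. (l, m) \<in> Poly_Mapping.keys \<mu>"
proof -
  have "(\<Sum>w\<in>Poly_Mapping.keys \<mu>.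
      Poly_Mapping.lookup (Poly_Mapping.single (fst w) (Poly_Mapping.lookup \<mu> w)) l) \<noteq> 0"
    using assms unfolding monom_deg_def lookup_sum by (rule gr_implies_not0)
  then obtain w where "w \<in> Poly_Mapping.keys \<mu>"
    "Poly_Mapping.lookup (Poly_Mapping.single (fst w) (Poly_Mapping.lookup \<mu> w)) l \<noteq> 0"
    by (rule sum.not_neutral_contains_not_neutral)
  then show ?thesis
    by (cases w) (auto simp: lookup_single when_def split: if_splits)
qed

text \<open>Each variable of block \<open>l\<close> contributes one factor \<open>c l\<close>, so
  the total factor depends on the multidegree alone. This is why the vanishing of a form does not
  depend on the representatives of a point.\<close>

lemma monom_eval_rescale:
  assumes "\<And>l m. (l, m) \<in> Poly_Mapping.keys \<mu> \<Longrightarrow> b l m = c l * a l m"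
  shows "monom_eval \<mu> b
    = (\<Prod>l\<in>Poly_Mapping.keys (monom_deg \<mu>). c l ^ Poly_Mapping.lookup (monom_deg \<mu>) l) * monom_eval \<mu> a"
proof -
  have "monom_eval \<mu> b = (\<Prod>v\<in>Poly_Mapping.keys \<mu>. c (fst v) ^ Poly_Mapping.lookup \<mu> v) * monom_eval \<mu> a"
    unfolding monom_eval_def prod.distrib[symmetric]
    by (intro prod.cong) (auto simp: assms power_mult_distrib)
  \<comment> \<open>The factor is the same monomial evaluated where all coordinates of block
    \<open>l\<close> equal \<open>c l\<close>; it remains to group the exponents by block.\<close>
  also have "(\<Prod>v\<in>Poly_Mapping.keys \<mu>. c (fst v) ^ Poly_Mapping.lookup \<mu> v) = monom_eval \<mu> (\<lambda>l _. c l)"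
    by (simp add: monom_eval_def)
  also have "\<dots> = (\<Prod>l\<in>Poly_Mapping.keys (monom_deg \<mu>). c l ^ Poly_Mapping.lookup (monom_deg \<mu>) l)"
  proof -
    let ?C = "\<lambda>i A. \<Prod>l\<in>A. c l ^ Poly_Mapping.lookup i l"
    have C: "?C i (Poly_Mapping.keys i) = ?C i A" if "finite A" "Poly_Mapping.keys i \<subseteq> A" for i A
      using that by (intro prod.mono_neutral_left) (auto simp: in_keys_iff)
    let ?A = "fst ` Poly_Mapping.keys \<mu>"
    have keys: "Poly_Mapping.keys (monom_deg \<mu>) \<subseteq> ?A"
    proof
      fix l assume "l \<in> Poly_Mapping.keys (monom_deg \<mu>)"
      then obtain m where "(l, m) \<in> Poly_Mapping.keys \<mu>"
        using lookup_monom_deg_pos[of \<mu> l] by (auto simp: in_keys_iff)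
      then show "l \<in> ?A"
        by (rule image_eqI[rotated]) simp
    qed
    have "?C (monom_deg \<mu>) ?A = (\<Prod>l\<in>?A. \<Prod>v\<in>Poly_Mapping.keys \<mu>.
        c l ^ Poly_Mapping.lookup (Poly_Mapping.single (fst v) (Poly_Mapping.lookup \<mu> v)) l)"
      by (simp only: monom_deg_def lookup_sum power_sum)
    also have "\<dots> = (\<Prod>v\<in>Poly_Mapping.keys \<mu>. \<Prod>l\<in>?A.
        c l ^ Poly_Mapping.lookup (Poly_Mapping.single (fst v) (Poly_Mapping.lookup \<mu> v)) l)"
      by (rule prod.swap)
    also have "\<dots> = (\<Prod>v\<in>Poly_Mapping.keys \<mu>. c (fst v) ^ Poly_Mapping.lookup \<mu> v)"
    proof (rule prod.cong[OF refl])
      fix v assume "v \<in> Poly_Mapping.keys \<mu>"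
      then show "(\<Prod>l\<in>?A. c l ^ Poly_Mapping.lookup (Poly_Mapping.single (fst v) (Poly_Mapping.lookup \<mu> v)) l)
        = c (fst v) ^ Poly_Mapping.lookup \<mu> v"
        by (subst prod.remove[of _ "fst v"]) (auto simp: lookup_single when_def intro!: prod.neutral)
    qed
    finally show ?thesis
      using C[OF _ keys] by (simp only: monom_eval_def finite_imageI finite_keys)
  qed
  finally show ?thesis .
qed

section \<open>Scalar multiplication, the coordinate ring and its spaces of forms\<close>

abbreviation (input) poly_scale :: "'a::comm_ring_1 \<Rightarrow> 'a mpoly \<Rightarrow> 'a mpoly" where
  "poly_scale c p \<equiv> Poly_Mapping.single 0 c * p"

abbreviation (input) fun_scale :: "'a::comm_ring_1 \<Rightarrow> ('b \<Rightarrow> 'a) \<Rightarrow> 'b \<Rightarrow> 'a" where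
  "fun_scale c f \<equiv> (\<lambda>x. c * f x)"

interpretation poly_vs: vector_space "poly_scale :: 'a::field \<Rightarrow> _"
  by unfold_locales
    (simp_all add: distrib_left distrib_right single_add mult_single flip: mult.assoc)

interpretation fun_vs: vector_space "fun_scale :: 'a::field \<Rightarrow> ('b \<Rightarrow> _) \<Rightarrow> _"
  by unfold_locales (simp_all add: fun_eq_iff algebra_simps)

lemma mpoly_ring_simps:
  "x \<otimes>\<^bsub>mpoly_ring k n\<^esub> y = x * y" "x \<oplus>\<^bsub>mpoly_ring k n\<^esub> y = x + y"
  "\<one>\<^bsub>mpoly_ring k n\<^esub> = 1" "\<zero>\<^bsub>mpoly_ring k n\<^esub> = 0"
  by (simp_all add: mpoly_ring_def ring_of_type_algebra_def)

lemma mem_mpoly_ring_iff: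
  "p \<in> carrier (mpoly_ring k n) \<longleftrightarrow> (\<forall>\<mu>\<in>Poly_Mapping.keys p. Poly_Mapping.keys \<mu> \<subseteq> mvars k n)"
  by (simp add: mpoly_ring_def)

text \<open>The ring laws are inherited from the ring on the whole polynomial type; only closure of
  the condition on the variables has to be checked.\<close>

lemma cring_mpoly_ring: "cring (mpoly_ring k n :: 'a::comm_ring_1 mpoly ring)"
proof -
  interpret T: cring "ring_of_type_algebra :: 'a mpoly ring"
    by (rule cring_from_type_algebra)
  have minus: "\<ominus>\<^bsub>ring_of_type_algebra\<^esub> p = - p" for p :: "'a mpoly"
    by (rule T.minus_equality) (simp_all add: ring_of_type_algebra_def)
  let ?C = "carrier (mpoly_ring k n) :: 'a mpoly set"
  have "subcring ?C ring_of_type_algebra"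
  proof (intro T.subcringI' T.subringI)
    fix p q :: "'a mpoly" assume pq: "p \<in> ?C" "q \<in> ?C"
    show "p \<otimes>\<^bsub>ring_of_type_algebra\<^esub> q \<in> ?C"
    proof -
      have "Poly_Mapping.keys \<mu> \<subseteq> mvars k n" if "\<mu> \<in> Poly_Mapping.keys (p * q)" for \<mu>
      proof -
        obtain \<mu>1 \<mu>2 where "\<mu> = \<mu>1 + \<mu>2" "\<mu>1 \<in> Poly_Mapping.keys p" "\<mu>2 \<in> Poly_Mapping.keys q"
          using keys_mult[of p q] \<open>\<mu> \<in> Poly_Mapping.keys (p * q)\<close> by blast
        then show ?thesis
          using Poly_Mapping.keys_add[of \<mu>1 \<mu>2] pq by (fastforce simp: mem_mpoly_ring_iff)
      qed
      then show ?thesis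
        by (simp add: mem_mpoly_ring_iff ring_of_type_algebra_def)
    qed
    show "p \<oplus>\<^bsub>ring_of_type_algebra\<^esub> q \<in> ?C"
      using Poly_Mapping.keys_add[of p q] pq
      by (fastforce simp: mem_mpoly_ring_iff ring_of_type_algebra_def)
  next
    fix p assume "p \<in> ?C"
    then show "\<ominus>\<^bsub>ring_of_type_algebra\<^esub> p \<in> ?C"
      by (simp add: minus mem_mpoly_ring_iff in_keys_iff)
  qed (auto simp: mem_mpoly_ring_iff ring_of_type_algebra_def)
  then show ?thesis
    using T.subcring_iff[of ?C] by (simp add: mpoly_ring_def ring_of_type_algebra_def)
qed

lemma formsE:
  assumes "p \<in> forms k n i" and "\<mu> \<in> Poly_Mapping.keys p"
  shows "Poly_Mapping.keys \<mu> \<subseteq> mvars k n" and "monom_deg \<mu> = i"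
  using assms by (auto simp: forms_def mem_mpoly_ring_iff)

lemma formsI:
  assumes "\<And>\<mu>. \<mu> \<in> Poly_Mapping.keys p \<Longrightarrow> Poly_Mapping.keys \<mu> \<subseteq> mvars k n \<and> monom_deg \<mu> = i"
  shows "p \<in> forms k n i"
  using assms by (auto simp: forms_def mem_mpoly_ring_iff)

lemma forms_add: "p \<in> forms k n i \<Longrightarrow> q \<in> forms k n i \<Longrightarrow> p + q \<in> forms k n i"
  using Poly_Mapping.keys_add[of p q] by (intro formsI) (auto dest: formsE)

lemma forms_0 [simp]: "0 \<in> forms k n i"
  by (simp add: forms_def mem_mpoly_ring_iff)

lemma forms_mult:
  assumes "p \<in> forms k n i" and "q \<in> forms k n j"
  shows "p * q \<in> forms k n (i + j)"
proof (rule formsI)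
  fix \<mu> assume "\<mu> \<in> Poly_Mapping.keys (p * q)"
  then obtain \<mu>1 \<mu>2 where "\<mu> = \<mu>1 + \<mu>2" "\<mu>1 \<in> Poly_Mapping.keys p" "\<mu>2 \<in> Poly_Mapping.keys q"
    using keys_mult[of p q] by blast
  moreover from this have "Poly_Mapping.keys \<mu>1 \<subseteq> mvars k n" "Poly_Mapping.keys \<mu>2 \<subseteq> mvars k n"
    "monom_deg \<mu>1 = i" "monom_deg \<mu>2 = j"
    using formsE[OF assms(1)] formsE[OF assms(2)] by simp_all
  ultimately show "Poly_Mapping.keys \<mu> \<subseteq> mvars k n \<and> monom_deg \<mu> = i + j"
    using Poly_Mapping.keys_add[of \<mu>1 \<mu>2] by (simp add: monom_deg_add) blast
qed

lemma const_in_forms: "Poly_Mapping.single 0 c \<in> forms k n 0"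
  by (rule formsI) (auto split: if_splits)

lemma mvar_in_forms:
  assumes "(l, m) \<in> mvars k n"
  shows "mvar l m \<in> forms k n (unit_deg l)"
  using assms by (intro formsI) (auto simp: mvar_def split: if_splits)

lemma forms_scale: "p \<in> forms k n i \<Longrightarrow> Poly_Mapping.single 0 c * p \<in> forms k n i"
  using forms_mult[OF const_in_forms, of p k n i c] by simp

lemma forms_sum: "(\<And>x. x \<in> A \<Longrightarrow> f x \<in> forms k n i) \<Longrightarrow> (\<Sum>x\<in>A. f x) \<in> forms k n i"
  by (induction A rule: infinite_finite_induct) (auto intro: forms_add)

lemma subspace_forms: "poly_vs.subspace (forms k n i :: 'a::field mpoly set)"
  by (intro poly_vs.subspaceI) (simp_all add: forms_add forms_scale)

lemma forms_subset_carrier: "forms k n i \<subseteq> carrier (mpoly_ring k n)"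
  by (auto simp: forms_def)

text \<open>An exponent of \<open>x_{l,m}\<close> is at most the \<open>l\<close>-th entry of the
  degree, so exponent vectors are functions from a finite set of variables into a bounded
  range.\<close>

lemma finite_monoms: "finite {\<mu>. Poly_Mapping.keys \<mu> \<subseteq> mvars k n \<and> monom_deg \<mu> = i}"
    (is "finite ?M")
proof -
  \<comment> \<open>The largest entry of \<open>i\<close>; inserting 0 covers \<open>i = 0\<close>,
    whose range is empty.\<close>
  let ?B = "{0..Max (insert 0 (Poly_Mapping.range i))}"
  have "finite {f. \<forall>v. (v \<in> mvars k n \<longrightarrow> f v \<in> ?B) \<and> (v \<notin> mvars k n \<longrightarrow> f v = (0::nat))}"
    by (rule finite_set_of_finite_funs) (auto simp: mvars_def)
  moreover have "Poly_Mapping.lookup ` ?M \<subseteq>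
      {f. \<forall>v. (v \<in> mvars k n \<longrightarrow> f v \<in> ?B) \<and> (v \<notin> mvars k n \<longrightarrow> f v = (0::nat))}"
  proof safe
    fix \<mu> :: monom and l m assume *: "Poly_Mapping.keys \<mu> \<subseteq> mvars k n"
    have "Poly_Mapping.lookup \<mu> (l, m) \<le> Poly_Mapping.lookup (monom_deg \<mu>) l"
      using lookup_monom_deg_ge[of \<mu> "(l, m)"] by simp
    also have "\<dots> \<le> Max (insert 0 (Poly_Mapping.range (monom_deg \<mu>)))"
    proof (rule Max_ge)
      show "Poly_Mapping.lookup (monom_deg \<mu>) l \<in> insert 0 (Poly_Mapping.range (monom_deg \<mu>))"
      proof (cases "l \<in> Poly_Mapping.keys (monom_deg \<mu>)")
        case True
        then show ?thesis
          by (rule insertI2[OF in_keys_lookup_in_range])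
      qed (simp add: in_keys_iff)
    qed simp
    finally show "Poly_Mapping.lookup \<mu> (l, m) \<in> {0..Max (insert 0 (Poly_Mapping.range (monom_deg \<mu>)))}"
      by simp
    show "Poly_Mapping.lookup \<mu> (l, m) = 0" if "(l, m) \<notin> mvars k n"
      using * that by (auto simp: in_keys_iff)
  qed
  ultimately have "finite (Poly_Mapping.lookup ` ?M)"
    by (rule finite_subset[rotated])
  then show ?thesis
  proof (rule finite_imageD)
    show "inj_on Poly_Mapping.lookup ?M"
      unfolding inj_on_def poly_mapping_eq_iff by blast
  qed
qed

lemma forms_finitely_spanned:
  "\<exists>T. finite T \<and> (forms k n i :: 'a::field mpoly set) \<subseteq> poly_vs.span T"
proof (intro exI conjI)
  let ?M = "{\<mu>. Poly_Mapping.keys \<mu> \<subseteq> mvars k n \<and> monom_deg \<mu> = i}"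
  let ?T = "(\<lambda>\<mu>. Poly_Mapping.single \<mu> (1::'a)) ` ?M"
  show "finite ?T"
    using finite_monoms by blast
  show "forms k n i \<subseteq> poly_vs.span ?T"
  proof
    fix p :: "'a mpoly" assume p: "p \<in> forms k n i"
    have "(\<Sum>\<mu>\<in>Poly_Mapping.keys p. Poly_Mapping.single \<mu> (Poly_Mapping.lookup p \<mu>)) \<in> poly_vs.span ?T"
    proof (rule poly_vs.span_sum)
      fix \<mu> assume "\<mu> \<in> Poly_Mapping.keys p"
      then have "Poly_Mapping.single \<mu> 1 \<in> poly_vs.span ?T"
        using formsE[OF p] by (intro poly_vs.span_base) auto
      from poly_vs.span_scale[OF this, of "Poly_Mapping.lookup p \<mu>"]
      show "Poly_Mapping.single \<mu> (Poly_Mapping.lookup p \<mu>) \<in> poly_vs.span ?T"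
        by (simp add: mult_single)
    qed
    then show "p \<in> poly_vs.span ?T"
      by (simp only: poly_mapping_sum_single[symmetric])
  qed
qed

text \<open>Every monomial whose degree has a positive \<open>l\<close>-th entry contains some
  variable of block \<open>l\<close>, which can be split off; the property is then extended by
  additivity. The coefficients are not unique.\<close>

lemma forms_decompose:
  assumes "p \<in> forms k n (d + unit_deg l)" and "l \<in> {1..k}"
  shows "\<exists>g. (\<forall>m\<in>{0..n l}. g m \<in> forms k n d) \<and> p = (\<Sum>m=0..n l. g m * mvar l m)"
proof -
  let ?P = "\<lambda>p. \<exists>g. (\<forall>m\<in>{0..n l}. g m \<in> forms k n d) \<and> p = (\<Sum>m=0..n l. g m * mvar l m)"
  have add: "?P (p + q)" if pq: "?P p" "?P q" for p q
  proof -
    obtain g h where "\<forall>m\<in>{0..n l}. g m \<in> forms k n d" "p = (\<Sum>m=0..n l. g m * mvar l m)"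
      "\<forall>m\<in>{0..n l}. h m \<in> forms k n d" "q = (\<Sum>m=0..n l. h m * mvar l m)"
      using pq by blast
    then show ?thesis
      by (intro exI[of _ "\<lambda>m. g m + h m"]) (auto simp: algebra_simps sum.distrib intro: forms_add)
  qed
  have single: "?P (Poly_Mapping.single \<mu> c)"
    if \<mu>: "Poly_Mapping.keys \<mu> \<subseteq> mvars k n" "monom_deg \<mu> = d + unit_deg l" for \<mu> c
  proof -
    obtain m where m: "(l, m) \<in> Poly_Mapping.keys \<mu>"
      using lookup_monom_deg_pos[of \<mu> l] \<mu>(2) by (auto simp: lookup_add)
    then have ml: "m \<in> {0..n l}"
      using \<mu>(1) by (auto simp: mvars_def)
    define \<nu> where "\<nu> = \<mu> - Poly_Mapping.single (l, m) 1"
    have \<mu>_eq: "\<mu> = \<nu> + Poly_Mapping.single (l, m) 1"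
      using m unfolding \<nu>_def
      by (intro poly_mapping_eqI) (auto simp: lookup_add lookup_minus lookup_single when_def in_keys_iff)
    have "Poly_Mapping.keys \<nu> \<subseteq> mvars k n"
      using \<mu>(1) by (auto simp: \<mu>_eq lookup_add in_keys_iff)
    moreover have "monom_deg \<nu> = d"
      using \<mu>(2) by (simp add: \<mu>_eq monom_deg_add)
    ultimately have "Poly_Mapping.single \<nu> c \<in> forms k n d"
      by (intro formsI) (auto split: if_splits)
    moreover have "Poly_Mapping.single \<mu> c = Poly_Mapping.single \<nu> c * mvar l m"
      by (simp add: \<mu>_eq mvar_def mult_single)
    moreover have "(\<Sum>h=0..n l. (if h = m then Poly_Mapping.single \<nu> c else 0) * mvar l h)
        = Poly_Mapping.single \<nu> c * mvar l m"
      using ml by (subst sum.remove[of _ m]) (auto intro!: sum.neutral)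
    ultimately show ?thesis
      by (intro exI[of _ "\<lambda>h. if h = m then Poly_Mapping.single \<nu> c else 0"]) auto
  qed
  have sum: "?P (\<Sum>\<mu>\<in>A. Poly_Mapping.single \<mu> (Poly_Mapping.lookup p \<mu>))"
    if "finite A" "A \<subseteq> Poly_Mapping.keys p" for A
    using that
  proof (induction A rule: finite_induct)
    case empty
    show ?case by (intro exI[of _ "\<lambda>_. 0"]) auto
  next
    case (insert \<mu> A)
    have "?P (Poly_Mapping.single \<mu> (Poly_Mapping.lookup p \<mu>))"
      using insert.prems formsE[OF assms(1)] by (intro single) auto
    from add[OF this insert.IH] show ?case
      using insert.prems insert.hyps by simp
  qed
  have "?P (\<Sum>\<mu>\<in>Poly_Mapping.keys p. Poly_Mapping.single \<mu> (Poly_Mapping.lookup p \<mu>))"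
    by (rule sum) auto
  then show ?thesis
    by (simp only: poly_mapping_sum_single[symmetric])
qed

lemma subfield_const_polys: "subfield (const_polys :: 'a::field mpoly set) (mpoly_ring k n)"
proof -
  interpret R: cring "mpoly_ring k n :: 'a mpoly ring"
    by (rule cring_mpoly_ring)
  have "ring_hom_ring ring_of_type_algebra (mpoly_ring k n) (Poly_Mapping.single 0 :: 'a \<Rightarrow> 'a mpoly)"
    by (rule ring_hom_ringI[OF ring_from_type_algebra R.ring_axioms])
      (auto simp: mpoly_ring_simps mem_mpoly_ring_iff mult_single single_add
        ring_of_type_algebra_def)
  then interpret h: ring_hom_ring ring_of_type_algebra "mpoly_ring k n"
    "Poly_Mapping.single 0 :: 'a \<Rightarrow> 'a mpoly" .
  interpret F: field "ring_of_type_algebra :: 'a ring"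
    by (rule field_from_type_algebra)
  show ?thesis
    using h.img_is_subfield(2)[OF F.carrier_is_subfield]
    by (simp add: mpoly_ring_simps const_polys_def) (simp add: ring_of_type_algebra_def)
qed

lemma dim_forms:
  "ring.dim (mpoly_ring k n) const_polys (forms k n i :: 'a::field mpoly set) = poly_vs.dim (forms k n i :: 'a mpoly set)"
proof -
  interpret R: cring "mpoly_ring k n :: 'a mpoly ring"
    by (rule cring_mpoly_ring)
  obtain T where T: "finite T" "(forms k n i :: 'a mpoly set) \<subseteq> poly_vs.span T"
    using forms_finitely_spanned by blast
  have "R.dim (range (Poly_Mapping.single 0)) ((\<lambda>p. p) ` forms k n i) = poly_vs.dim (forms k n i :: 'a mpoly set)"
    by (rule R.dim_image_subspace[OF poly_vs.vector_space_axioms subspace_forms T])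
      (use subfield_const_polys[where 'a='a] subsetD[OF forms_subset_carrier] in
        \<open>auto simp: mpoly_ring_simps const_polys_def\<close>)
  then show ?thesis
    by (simp add: const_polys_def)
qed

lemma mpoly_ring_uminus:
  assumes "p \<in> carrier (mpoly_ring k n)"
  shows "\<ominus>\<^bsub>mpoly_ring k n\<^esub> p = - p"
proof -
  interpret R: cring "mpoly_ring k n :: 'a mpoly ring"
    by (rule cring_mpoly_ring)
  have "- p \<in> carrier (mpoly_ring k n)"
    using assms by (simp add: mem_mpoly_ring_iff in_keys_iff)
  with assms show ?thesis
    by (intro R.minus_equality) (simp_all add: mpoly_ring_simps)
qed

lemma mpoly_ring_minus:
  assumes "p \<in> carrier (mpoly_ring k n)" and "q \<in> carrier (mpoly_ring k n)"
  shows "p \<ominus>\<^bsub>mpoly_ring k n\<^esub> q = p - q"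
  using assms by (simp add: a_minus_def mpoly_ring_uminus mpoly_ring_simps)

lemma forms_diff:
  fixes p q :: "'a::field mpoly"
  shows "p \<in> forms k n i \<Longrightarrow> q \<in> forms k n i \<Longrightarrow> p - q \<in> forms k n i"
  by (rule poly_vs.subspace_diff[OF subspace_forms])

section \<open>Finite sets of points in a product of projective spaces\<close>

lemma proj_space_nonempty:
  fixes Q :: "(nat \<Rightarrow> 'a::field) set"
  assumes "Q \<in> proj_space N"
  shows "\<exists>a. a \<in> Q"
proof -
  obtain x where "Q = {b. \<exists>c. c \<noteq> 0 \<and> (\<forall>m. b m = c * x m)}"
    using assms unfolding proj_space_def quotient_def by auto
  then have "x \<in> Q"
    by (auto intro!: exI[of _ "1::'a"])
  then show ?thesis by blast
qed

lemma proj_space_nonzero: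
  assumes "Q \<in> proj_space N" and "a \<in> Q"
  shows "\<exists>m\<le>N. a m \<noteq> 0"
proof -
  obtain x c m where "m \<le> N" "x m \<noteq> 0" "c \<noteq> 0" "\<forall>m. a m = c * x m"
    using assms unfolding proj_space_def quotient_def by auto
  then show ?thesis
    by (intro exI[of _ m]) simp
qed

lemma proj_space_proportional:
  assumes "Q \<in> proj_space N" and "a \<in> Q" and "b \<in> Q"
  shows "\<exists>c. \<forall>m. b m = c * a m"
proof -
  obtain x c d where "c \<noteq> 0" "\<forall>m. a m = c * x m" "\<forall>m. b m = d * x m"
    using assms unfolding proj_space_def quotient_def by auto
  then show ?thesis
    by (intro exI[of _ "d / c"]) simp
qed

locale multiproj_points =
  fixes k :: nat
    and n :: "nat \<Rightarrow> nat"
    and \<X> :: "(nat \<Rightarrow> (nat \<Rightarrow> 'a::field_char_0) set) set"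
  assumes points: "\<X> \<subseteq> multiproj_space k n"
    and finite_points: "finite \<X>"
    and nonempty: "\<X> \<noteq> {}"
begin

abbreviation "R \<equiv> mpoly_ring k n :: 'a mpoly ring"
abbreviation "I \<equiv> point_ideal k n \<X>"

sublocale R: cring R
  by (rule cring_mpoly_ring)

definition rep :: "(nat \<Rightarrow> (nat \<Rightarrow> 'a) set) \<Rightarrow> nat \<Rightarrow> nat \<Rightarrow> 'a" where
  "rep P = (\<lambda>l. SOME a. a \<in> P l)"

text \<open>Functions on the points are encoded as total functions that are 0 off
  \<open>\<X>\<close>, so that the value spaces have finite dimension and equality of value vectors
  is decided on \<open>\<X>\<close>.\<close>

definition ev :: "'a mpoly \<Rightarrow> (nat \<Rightarrow> (nat \<Rightarrow> 'a) set) \<Rightarrow> 'a" where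
  "ev p = (\<lambda>P. if P \<in> \<X> then peval p (rep P) else 0)"

definition V :: "multideg \<Rightarrow> ((nat \<Rightarrow> (nat \<Rightarrow> 'a) set) \<Rightarrow> 'a) set" where
  "V i = ev ` forms k n i"

lemma proj_coord: "P \<in> \<X> \<Longrightarrow> l \<in> {1..k} \<Longrightarrow> P l \<in> proj_space (n l)"
  using points by (auto simp: multiproj_space_def PiE_def Pi_def)

lemma rep_in: "P \<in> \<X> \<Longrightarrow> l \<in> {1..k} \<Longrightarrow> rep P l \<in> P l"
  unfolding rep_def using proj_space_nonempty[OF proj_coord] by (rule someI_ex)

lemma ev_eq_0_iff: "ev p = 0 \<longleftrightarrow> (\<forall>P\<in>\<X>. peval p (rep P) = 0)"
  by (auto simp: ev_def fun_eq_iff)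

lemma ev_add: "ev (p + q) = ev p + ev q"
  by (auto simp: ev_def fun_eq_iff peval_add)

lemma ev_mult: "ev (p * q) = ev p * ev q"
  by (auto simp: ev_def fun_eq_iff peval_mult)

lemma ev_scale: "ev (poly_scale c p) = fun_scale c (ev p)"
  by (auto simp: ev_def fun_eq_iff peval_mult)

lemma ev_0 [simp]: "ev 0 = 0"
  by (auto simp: ev_def fun_eq_iff)

lemma linear_ev: "Vector_Spaces.linear poly_scale fun_scale ev"
  by unfold_locales (simp_all add: ev_add ev_scale)

lemma ev_diff: "ev (p - q) = ev p - ev q"
proof -
  interpret Vector_Spaces.linear poly_scale fun_scale ev by (rule linear_ev)
  show ?thesis by (rule diff)
qed

lemma ev_sum: "ev (\<Sum>x\<in>A. f x) = (\<Sum>x\<in>A. ev (f x))"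
  by (induction A rule: infinite_finite_induct) (simp_all add: ev_add)

text \<open>Other representatives differ from \<open>rep P\<close> by one scalar for each block, and
  homogeneity turns these into a common factor of all terms of \<open>p\<close>.\<close>

lemma vanishes_at_iff:
  assumes "p \<in> forms k n i" and P: "P \<in> \<X>"
  shows "vanishes_at k p P \<longleftrightarrow> peval p (rep P) = 0"
proof
  assume "vanishes_at k p P"
  then show "peval p (rep P) = 0"
    using rep_in[OF P] by (simp add: vanishes_at_def)
next
  assume 0: "peval p (rep P) = 0"
  show "vanishes_at k p P"
    unfolding vanishes_at_def
  proof safe
    fix a assume a: "\<forall>l\<in>{1..k}. a l \<in> P l"
    then have "\<forall>l\<in>{1..k}. \<exists>c. \<forall>m. a l m = c * rep P l m"
      using proj_space_proportional[OF proj_coord[OF P] rep_in[OF P]] by blast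
    then obtain c where c: "\<And>l m. l \<in> {1..k} \<Longrightarrow> a l m = c l * rep P l m"
      by (metis bchoice)
    have "peval p a = (\<Sum>\<mu>\<in>Poly_Mapping.keys p. Poly_Mapping.lookup p \<mu> * monom_eval \<mu> a)"
      by (rule peval_superset) auto
    also have "\<dots> = (\<Sum>\<mu>\<in>Poly_Mapping.keys p. (\<Prod>l\<in>Poly_Mapping.keys i. c l ^ Poly_Mapping.lookup i l)
        * (Poly_Mapping.lookup p \<mu> * monom_eval \<mu> (rep P)))"
    proof (rule sum.cong[OF refl])
      fix \<mu> assume \<mu>: "\<mu> \<in> Poly_Mapping.keys p"
      have "monom_eval \<mu> a = (\<Prod>l\<in>Poly_Mapping.keys (monom_deg \<mu>).
          c l ^ Poly_Mapping.lookup (monom_deg \<mu>) l) * monom_eval \<mu> (rep P)"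
        using formsE(1)[OF assms(1) \<mu>] c by (intro monom_eval_rescale) (auto simp: mvars_def)
      then show "Poly_Mapping.lookup p \<mu> * monom_eval \<mu> a = (\<Prod>l\<in>Poly_Mapping.keys i. c l ^ Poly_Mapping.lookup i l)
        * (Poly_Mapping.lookup p \<mu> * monom_eval \<mu> (rep P))"
        by (simp add: formsE(2)[OF assms(1) \<mu>] mult.left_commute)
    qed
    also have "\<dots> = (\<Prod>l\<in>Poly_Mapping.keys i. c l ^ Poly_Mapping.lookup i l) * peval p (rep P)"
      by (simp add: sum_distrib_left peval_superset[OF _ order_refl])
    finally show "peval p a = 0"
      using 0 by simp
  qed
qed

text \<open>An upper bound for \<open>I\<close>. It can be larger, since a nonhomogeneous polynomial
  may vanish at the chosen representatives, but the two agree on the forms of each degree.\<close>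

lemma ideal_vanishing: "ideal {p \<in> carrier R. ev p = 0} R"
proof (rule idealI[OF R.ring_axioms])
  show "subgroup {p \<in> carrier R. ev p = 0} (add_monoid R)"
  proof (rule R.add.subgroupI)
    show "{p \<in> carrier R. ev p = 0} \<noteq> {}"
      using R.zero_closed by (auto simp: mpoly_ring_simps)
  next
    fix p assume p: "p \<in> {p \<in> carrier R. ev p = 0}"
    then have "\<ominus>\<^bsub>R\<^esub> p = 0 - p"
      by (simp add: mpoly_ring_uminus)
    then have "ev (\<ominus>\<^bsub>R\<^esub> p) = 0"
      using p by (simp only: ev_diff) simp
    then show "\<ominus>\<^bsub>R\<^esub> p \<in> {p \<in> carrier R. ev p = 0}"
      using p R.a_inv_closed by blast
  next
    fix p q assume "p \<in> {p \<in> carrier R. ev p = 0}" "q \<in> {p \<in> carrier R. ev p = 0}"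
    then show "p \<oplus>\<^bsub>R\<^esub> q \<in> {p \<in> carrier R. ev p = 0}"
      using R.a_closed by (simp add: ev_add mpoly_ring_simps)
  qed auto
next
  fix p q assume p: "p \<in> {p \<in> carrier R. ev p = 0}" and q: "q \<in> carrier R"
  have "p * q \<in> carrier R" "q * p \<in> carrier R"
    using R.m_closed[of p q] R.m_closed[of q p] p q by (simp_all add: mpoly_ring_simps)
  then show "q \<otimes>\<^bsub>R\<^esub> p \<in> {p \<in> carrier R. ev p = 0}" "p \<otimes>\<^bsub>R\<^esub> q \<in> {p \<in> carrier R. ev p = 0}"
    using p by (simp_all add: ev_mult mpoly_ring_simps)
qed

lemma ideal_I: "ideal I R"
  unfolding point_ideal_def using forms_subset_carrier by (intro R.genideal_ideal) blast

lemma I_ev: "p \<in> I \<Longrightarrow> ev p = 0"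
proof -
  have "I \<subseteq> {p \<in> carrier R. ev p = 0}"
    unfolding point_ideal_def
  proof (rule R.genideal_minimal[OF ideal_vanishing], safe)
    fix p i assume p: "p \<in> forms k n i" "\<forall>P\<in>\<X>. vanishes_at k p P"
    then show "p \<in> carrier R"
      using forms_subset_carrier by blast
    show "ev p = 0"
      using p vanishes_at_iff[OF p(1)] by (simp add: ev_eq_0_iff)
  qed
  then show "p \<in> I \<Longrightarrow> ev p = 0" by blast
qed

text \<open>A form with zero values is one of the generators in the definition of the ideal;
  conversely all elements of the ideal have zero values.\<close>

lemma point_ideal_deg_iff:
  assumes "i \<in> multidegs {1..k}"
  shows "p \<in> point_ideal_deg k n \<X> i \<longleftrightarrow> p \<in> forms k n i \<and> ev p = 0"
proof
  assume "p \<in> forms k n i \<and> ev p = 0"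
  then have "p \<in> {p. \<exists>i\<in>multidegs {1..k}. p \<in> forms k n i \<and> (\<forall>P\<in>\<X>. vanishes_at k p P)}"
    using assms by (auto simp: ev_eq_0_iff vanishes_at_iff)
  also have "\<dots> \<subseteq> I"
    unfolding point_ideal_def using forms_subset_carrier by (intro R.genideal_self) blast
  finally show "p \<in> point_ideal_deg k n \<X> i"
    using \<open>p \<in> forms k n i \<and> ev p = 0\<close> by (simp add: point_ideal_deg_def)
qed (simp add: point_ideal_deg_def I_ev)

section \<open>The Hilbert function as the dimension of the value spaces\<close>

lemma subspace_V: "fun_vs.subspace (V i)"
proof -
  interpret Vector_Spaces.linear poly_scale fun_scale ev by (rule linear_ev)
  show ?thesis
    unfolding V_def by (rule subspace_image[OF subspace_forms])
qed

lemma V_finitely_spanned: "\<exists>T. finite T \<and> card T \<le> card \<X> \<and> V i \<subseteq> fun_vs.span T"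
proof (intro exI conjI)
  \<comment> \<open>The indicator functions of the points: a value vector is 0 off
    \<open>\<X>\<close>, hence a combination of these.\<close>
  let ?\<delta> = "\<lambda>P Q. if Q = P then (1::'a) else 0"
  show "finite (?\<delta> ` \<X>)" "card (?\<delta> ` \<X>) \<le> card \<X>"
    using finite_points by (auto intro: card_image_le)
  show "V i \<subseteq> fun_vs.span (?\<delta> ` \<X>)"
  proof
    fix v assume "v \<in> V i"
    then have v: "v Q = 0" if "Q \<notin> \<X>" for Q
      using that by (auto simp: V_def ev_def)
    have "(\<Sum>P\<in>\<X>. fun_scale (v P) (?\<delta> P)) \<in> fun_vs.span (?\<delta> ` \<X>)"
      by (intro fun_vs.span_sum fun_vs.span_scale fun_vs.span_base) auto
    moreover have "(\<Sum>P\<in>\<X>. fun_scale (v P) (?\<delta> P)) = v"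
    proof
      fix Q
      have "(\<Sum>P\<in>\<X>. fun_scale (v P) (?\<delta> P)) Q = (\<Sum>P\<in>\<X>. if Q = P then v P else 0)"
        using finite_points by (induction rule: finite_induct) auto
      also have "\<dots> = v Q"
        using v[of Q] finite_points by simp
      finally show "(\<Sum>P\<in>\<X>. fun_scale (v P) (?\<delta> P)) Q = v Q" .
    qed
    ultimately show "v \<in> fun_vs.span (?\<delta> ` \<X>)"
      by simp
  qed
qed

lemma dim_V_le: "fun_vs.dim (V i) \<le> card \<X>"
proof -
  obtain T where "finite T" "card T \<le> card \<X>" "V i \<subseteq> fun_vs.span T"
    using V_finitely_spanned by blast
  then show ?thesis
    using fun_vs.dim_le_card[of "V i" T] by simp
qed

text \<open>The isomorphism theorem in one degree: evaluation on forms of degree \<open>i\<close>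
  has the degree \<open>i\<close> part of the ideal as its kernel, so its image is a copy of the
  graded piece of the quotient.\<close>

lemma hilbert_fun_eq:
  assumes "i \<in> multidegs {1..k}"
  shows "hilbert_fun k n \<X> i = fun_vs.dim (V i)"
proof -
  interpret I: ideal I R by (rule ideal_I)
  define cls where "cls = (\<lambda>p. I +>\<^bsub>R\<^esub> p)"
  interpret h: ring_hom_ring R "R Quot I" cls
    unfolding cls_def by (rule I.rcos_ring_hom_ring)
  have car: "p \<in> carrier R" if "p \<in> forms k n i" for p
    using that forms_subset_carrier by blast
  have const: "Poly_Mapping.single 0 c \<in> carrier R" for c
    by (rule subsetD[OF forms_subset_carrier const_in_forms])
  have cls_eq: "cls p = cls q \<longleftrightarrow> p - q \<in> I" if "p \<in> carrier R" "q \<in> carrier R" for p q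
    using R.quotient_eq_iff_same_a_r_cos[OF ideal_I that] that
    by (simp add: cls_def mpoly_ring_minus)
  have cls_add: "cls (p + q) = cls p \<oplus>\<^bsub>R Quot I\<^esub> cls q" if "p \<in> carrier R" "q \<in> carrier R" for p q
    using h.hom_add[OF that] by (simp add: mpoly_ring_simps)
  have cls_mult: "cls (p * q) = cls p \<otimes>\<^bsub>R Quot I\<^esub> cls q" if "p \<in> carrier R" "q \<in> carrier R" for p q
    using h.hom_mult[OF that] by (simp add: mpoly_ring_simps)
  \<comment> \<open>A choice of preimage under \<open>ev\<close>, followed by the class map. The
    choice does not matter, since two forms with the same values differ by an element of the
    ideal.\<close>
  define g where "g = (\<lambda>v. cls (SOME p. p \<in> forms k n i \<and> ev p = v))"
  have g: "g (ev p) = cls p" if p: "p \<in> forms k n i" for p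
  proof -
    define q where "q = (SOME q. q \<in> forms k n i \<and> ev q = ev p)"
    have q: "q \<in> forms k n i \<and> ev q = ev p"
      unfolding q_def by (rule someI[of _ p]) (simp add: p)
    have "q - p \<in> point_ideal_deg k n \<X> i"
      using q p by (simp add: point_ideal_deg_iff[OF assms] forms_diff ev_diff)
    then have "cls q = cls p"
      using q p by (simp add: cls_eq car point_ideal_deg_def)
    then show ?thesis
      by (simp add: g_def q_def)
  qed
  define \<phi> where "\<phi> = (\<lambda>c. cls (Poly_Mapping.single 0 c))"
  have \<phi>: "range \<phi> = cls ` const_polys"
    by (simp add: \<phi>_def const_polys_def image_image)
  \<comment> \<open>Some point exists, and 1 does not vanish there. So the quotient ring is
    nontrivial and the constants still form a field in it.\<close>
  have "1 \<notin> I"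
  proof
    assume "1 \<in> I"
    then have "ev 1 = 0" by (rule I_ev)
    then have "ev (Poly_Mapping.single 0 1) = 0" by simp
    then show False
      using nonempty by (auto simp: ev_eq_0_iff simp del: single_one)
  qed
  then have "\<one>\<^bsub>R Quot I\<^esub> \<noteq> \<zero>\<^bsub>R Quot I\<^esub>"
    using cls_eq[OF R.one_closed R.zero_closed] h.hom_one h.hom_zero by (simp add: mpoly_ring_simps)
  then have sub: "subfield (range \<phi>) (R Quot I)"
    unfolding \<phi> by (rule h.img_is_subfield(2)[OF subfield_const_polys])
  obtain T where T: "finite T" "V i \<subseteq> fun_vs.span T"
    using V_finitely_spanned by blast
  have "h.S.dim (range \<phi>) (g ` V i) = fun_vs.dim (V i)"
  proof (rule h.S.dim_image_subspace[OF fun_vs.vector_space_axioms subspace_V T sub])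
    show "g x \<in> carrier (R Quot I)" if "x \<in> V i" for x
      using that by (auto simp: V_def g car)
    show "g (x + y) = g x \<oplus>\<^bsub>R Quot I\<^esub> g y" if xy: "x \<in> V i" "y \<in> V i" for x y
    proof -
      obtain p q where pq: "p \<in> forms k n i" "x = ev p" "q \<in> forms k n i" "y = ev q"
        using xy unfolding V_def by blast
      have "g (x + y) = g (ev (p + q))"
        by (simp add: pq ev_add)
      then show ?thesis
        using pq by (simp add: g forms_add cls_add car)
    qed
    show "g (fun_scale c x) = \<phi> c \<otimes>\<^bsub>R Quot I\<^esub> g x" if x: "x \<in> V i" for c x
    proof -
      obtain p where p: "p \<in> forms k n i" "x = ev p"
        using x unfolding V_def by blast
      have "g (fun_scale c x) = g (ev (poly_scale c p))"
        unfolding p ev_scale ..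
      then show ?thesis
        using p const car by (simp add: g forms_scale cls_mult \<phi>_def)
    qed
    show "inj_on g (V i)"
    proof (rule inj_onI)
      fix x y assume xy: "x \<in> V i" "y \<in> V i" "g x = g y"
      then obtain p q where pq: "p \<in> forms k n i" "x = ev p" "q \<in> forms k n i" "y = ev q"
        unfolding V_def by blast
      then have "p - q \<in> I"
        using xy(3) by (simp add: g cls_eq car)
      then have "ev (p - q) = 0" by (rule I_ev)
      then show "x = y"
        by (simp add: pq ev_diff)
    qed
  qed
  moreover have "g ` V i = cls ` forms k n i"
    unfolding V_def image_image by (rule image_cong) (simp_all add: g)
  ultimately show ?thesis
    by (simp add: hilbert_fun_def Let_def cls_def \<phi>)
qed

section \<open>Multiplication by a linear form without zeros on the points\<close>

lemma exists_nonvanishing_linear_form: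
  assumes l: "l \<in> {1..k}"
  shows "\<exists>L\<in>forms k n (unit_deg l). \<forall>P\<in>\<X>. peval L (rep P) \<noteq> 0"
proof -
  \<comment> \<open>\<open>q P\<close> is the value at \<open>P\<close> of the form with
    coefficients 1, t, t^2, ..., as a polynomial in t. Its coefficients are the coordinates of a
    representative, not all zero, so only finitely many t are bad for \<open>P\<close>.\<close>
  define q where "q P = (\<Sum>m=0..n l. monom (rep P l m) m)" for P
  have q: "q P \<noteq> 0" if P: "P \<in> \<X>" for P
  proof -
    obtain m where "m \<le> n l" "rep P l m \<noteq> 0"
      using proj_space_nonzero[OF proj_coord[OF P l] rep_in[OF P l]] by blast
    then have "coeff (q P) m \<noteq> 0"
      by (simp add: q_def coeff_sum)
    then show ?thesis by auto
  qed
  have "finite (\<Union>P\<in>\<X>. {t. poly (q P) t = 0})"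
    using finite_points q by (intro finite_UN_I poly_roots_finite)
  then obtain t where t: "t \<notin> (\<Union>P\<in>\<X>. {t. poly (q P) t = 0})"
    using ex_new_if_finite[OF infinite_UNIV_char_0] by blast
  define L :: "'a mpoly" where "L = (\<Sum>m=0..n l. poly_scale (t ^ m) (mvar l m))"
  have "peval L (rep P) = poly (q P) t" for P
    by (simp add: L_def q_def peval_sum peval_mult poly_sum poly_monom mult.commute)
  moreover have "L \<in> forms k n (unit_deg l)"
    unfolding L_def using l by (intro forms_sum forms_scale mvar_in_forms) (auto simp: mvars_def)
  ultimately show ?thesis
    using t by (intro bexI[of _ L]) auto
qed

definition lin :: "nat \<Rightarrow> 'a mpoly" where
  "lin l = (SOME L. L \<in> forms k n (unit_deg l) \<and> (\<forall>P\<in>\<X>. peval L (rep P) \<noteq> 0))"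

lemma
  assumes "l \<in> {1..k}"
  shows lin_in_forms: "lin l \<in> forms k n (unit_deg l)"
    and ev_lin_nonzero: "P \<in> \<X> \<Longrightarrow> ev (lin l) P \<noteq> 0"
proof -
  have "lin l \<in> forms k n (unit_deg l) \<and> (\<forall>P\<in>\<X>. peval (lin l) (rep P) \<noteq> 0)"
    unfolding lin_def by (rule someI_ex) (use exists_nonvanishing_linear_form[OF assms] in blast)
  then show "lin l \<in> forms k n (unit_deg l)" "P \<in> \<X> \<Longrightarrow> ev (lin l) P \<noteq> 0"
    by (auto simp: ev_def)
qed

lemma lin_mult_V_subset:
  assumes "l \<in> {1..k}"
  shows "(*) (ev (lin l)) ` V d \<subseteq> V (d + unit_deg l)"
proof
  fix v assume "v \<in> (*) (ev (lin l)) ` V d"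
  then obtain p where p: "p \<in> forms k n d" "v = ev (lin l) * ev p"
    unfolding V_def by blast
  then have "v = ev (p * lin l)"
    by (simp add: ev_mult mult.commute)
  then show "v \<in> V (d + unit_deg l)"
    unfolding V_def using forms_mult[OF p(1) lin_in_forms[OF assms]] by blast
qed

lemma linear_mult_fun: "Vector_Spaces.linear fun_scale fun_scale ((*) (u :: 'b \<Rightarrow> 'a))"
  by unfold_locales (simp_all add: fun_eq_iff algebra_simps)

text \<open>Multiplication is injective: the factor can be cancelled at each point of
  \<open>\<X>\<close>, and off \<open>\<X>\<close> all value vectors are 0.\<close>

lemma dim_lin_mult_V:
  assumes "l \<in> {1..k}"
  shows "fun_vs.dim ((*) (ev (lin l)) ` V d) = fun_vs.dim (V d)"
proof (rule fun_vs.dim_injective_image[OF fun_vs.vector_space_axioms linear_mult_fun subspace_V])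
  show "inj_on ((*) (ev (lin l))) (V d)"
  proof (rule inj_onI, rule ext)
    fix v w P assume v: "v \<in> V d" and w: "w \<in> V d" and eq: "ev (lin l) * v = ev (lin l) * w"
    show "v P = w P"
    proof (cases "P \<in> \<X>")
      case True
      have "ev (lin l) P * v P = ev (lin l) P * w P"
        using fun_cong[OF eq, of P] by simp
      then show ?thesis
        using ev_lin_nonzero[OF assms True] by simp
    next
      case False
      then show ?thesis
        using v w by (auto simp: V_def ev_def)
    qed
  qed
qed

lemma dim_V_mono:
  assumes "l \<in> {1..k}"
  shows "fun_vs.dim (V d) \<le> fun_vs.dim (V (d + unit_deg l))"
proof -
  obtain T where T: "finite T" "V (d + unit_deg l) \<subseteq> fun_vs.span T"
    using V_finitely_spanned by blast
  show ?thesis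
    using fun_vs.dim_subset_finite[OF lin_mult_V_subset[OF assms] T] dim_lin_mult_V[OF assms] by simp
qed

lemma V_eq_if_dim_eq:
  assumes "l \<in> {1..k}" and "fun_vs.dim (V d) = fun_vs.dim (V (d + unit_deg l))"
  shows "V (d + unit_deg l) = (*) (ev (lin l)) ` V d"
proof -
  interpret Vector_Spaces.linear fun_scale fun_scale "(*) (ev (lin l))" by (rule linear_mult_fun)
  obtain T where T: "finite T" "V (d + unit_deg l) \<subseteq> fun_vs.span T"
    using V_finitely_spanned by blast
  show ?thesis
    using fun_vs.subspace_eqI_dim[OF subspace_image[OF subspace_V] subspace_V lin_mult_V_subset[OF assms(1)] T]
      dim_lin_mult_V[OF assms(1)] assms(2) by simp
qed

text \<open>
  Once multiplication by the linear form maps onto the values in degree \<open>d + e\<^sub>l\<close>, every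
  coefficient of a form of degree \<open>d + 2e\<^sub>l\<close> can be reduced modulo the ideal to a multiple of
  the linear form.
\<close>

lemma reduce_form:
  assumes l: "l \<in> {1..k}" and V: "V (d + unit_deg l) = (*) (ev (lin l)) ` V d"
    and f: "f \<in> forms k n (d + unit_deg l + unit_deg l)"
  shows "\<exists>w u. w \<in> forms k n (d + unit_deg l) \<and> ev f = ev (lin l) * ev w \<and>
    (\<forall>m\<in>{0..n l}. u m \<in> forms k n (d + unit_deg l) \<and> ev (u m) = 0) \<and>
    f = lin l * w + (\<Sum>m=0..n l. u m * mvar l m)"
proof -
  obtain g where g: "\<forall>m\<in>{0..n l}. g m \<in> forms k n (d + unit_deg l)"
    "f = (\<Sum>m=0..n l. g m * mvar l m)"
    using forms_decompose[OF f l] by blast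
  have "\<exists>h. h \<in> forms k n d \<and> ev (g m) = ev (lin l) * ev h" if "m \<in> {0..n l}" for m
  proof -
    have "ev (g m) \<in> V (d + unit_deg l)"
      unfolding V_def using g(1) that by blast
    then show ?thesis
      unfolding V unfolding V_def by blast
  qed
  then obtain h where h: "\<And>m. m \<in> {0..n l} \<Longrightarrow> h m \<in> forms k n d"
    "\<And>m. m \<in> {0..n l} \<Longrightarrow> ev (g m) = ev (lin l) * ev (h m)"
    by metis
  define w where "w = (\<Sum>m=0..n l. h m * mvar l m)"
  define u where "u = (\<lambda>m. g m - lin l * h m)"
  have w: "w \<in> forms k n (d + unit_deg l)"
    unfolding w_def using h(1) l by (intro forms_sum forms_mult mvar_in_forms) (auto simp: mvars_def)
  have u: "u m \<in> forms k n (d + unit_deg l) \<and> ev (u m) = 0" if "m \<in> {0..n l}" for m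
  proof -
    have "h m * lin l \<in> forms k n (d + unit_deg l)"
      using h(1)[OF that] lin_in_forms[OF l] by (rule forms_mult)
    then show ?thesis
      using g(1) that h(2)[OF that] by (simp add: u_def forms_diff mult.commute ev_diff ev_mult)
  qed
  have f_eq: "f = lin l * w + (\<Sum>m=0..n l. u m * mvar l m)"
    by (simp add: g(2) w_def u_def sum_distrib_left algebra_simps flip: sum.distrib)
  have "ev (\<Sum>m=0..n l. u m * mvar l m) = 0"
    using u by (simp add: ev_sum ev_mult)
  then have "ev f = ev (lin l) * ev w"
    by (simp add: f_eq ev_add ev_mult)
  with w u f_eq show ?thesis by blast
qed

text \<open>The cofactor \<open>w\<close> of the reduction has degree \<open>d + e_l\<close>, so the
  hypothesis reproduces itself one degree higher.\<close>

lemma V_eq_Suc: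
  assumes l: "l \<in> {1..k}" and V: "V (d + unit_deg l) = (*) (ev (lin l)) ` V d"
  shows "V (d + unit_deg l + unit_deg l) = (*) (ev (lin l)) ` V (d + unit_deg l)"
proof
  show "V (d + unit_deg l + unit_deg l) \<subseteq> (*) (ev (lin l)) ` V (d + unit_deg l)"
  proof
    fix v assume "v \<in> V (d + unit_deg l + unit_deg l)"
    then obtain f where f: "f \<in> forms k n (d + unit_deg l + unit_deg l)" "v = ev f"
      unfolding V_def by blast
    obtain w where "w \<in> forms k n (d + unit_deg l)" "ev f = ev (lin l) * ev w"
      using reduce_form[OF l V f(1)] by blast
    then show "v \<in> (*) (ev (lin l)) ` V (d + unit_deg l)"
      unfolding f(2) V_def by blast
  qed
qed (rule lin_mult_V_subset[OF l])

text \<open>The reduction leaves a term \<open>lin l * w\<close> with \<open>w\<close> in the ideal.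
  Expanding \<open>lin l\<close> in the variables of block \<open>l\<close> merges this term with
  the \<open>u m\<close>, so a single direction \<open>l\<close> suffices.\<close>

lemma var_mult_piece_if_V_eq:
  assumes l: "l \<in> {1..k}" and d: "d \<in> multidegs {1..k}"
    and V: "V (d + unit_deg l) = (*) (ev (lin l)) ` V d"
    and f: "f \<in> forms k n (d + unit_deg l + unit_deg l)" "ev f = 0"
  shows "f \<in> var_mult_piece k n \<X> (d + unit_deg l + unit_deg l) l"
proof -
  let ?d = "d + unit_deg l"
  have dm: "?d \<in> multidegs {1..k}"
    using d l Poly_Mapping.keys_add[of d "unit_deg l"] by (auto simp: multidegs_def)
  obtain w u where w: "w \<in> forms k n ?d" "ev f = ev (lin l) * ev w"
    and u: "\<And>m. m \<in> {0..n l} \<Longrightarrow> u m \<in> forms k n ?d \<and> ev (u m) = 0"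
    and f_eq: "f = lin l * w + (\<Sum>m=0..n l. u m * mvar l m)"
    using reduce_form[OF l V f(1)] by blast
  \<comment> \<open>The linear form is nonzero at every point, so the zeros of \<open>f\<close> pass
    to \<open>w\<close>.\<close>
  have ev_w: "ev w = 0"
  proof
    fix P
    have "ev (lin l) P * ev w P = 0"
      using fun_cong[OF w(2), of P] f(2) by simp
    then show "ev w P = 0 P"
      using ev_lin_nonzero[OF l, of P] by (cases "P \<in> \<X>") (auto simp: ev_def)
  qed
  \<comment> \<open>\<open>lin l\<close> is known only through its properties; decomposing it in
    degree \<open>0 + e_l\<close> recovers its coefficients as forms of degree 0.\<close>
  obtain c where c: "\<forall>m\<in>{0..n l}. c m \<in> forms k n 0" "lin l = (\<Sum>m=0..n l. c m * mvar l m)"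
    using forms_decompose[of "lin l" k n 0 l] lin_in_forms[OF l] l by auto
  define b where "b = (\<lambda>m. c m * w + u m)"
  have "lin l * w = (\<Sum>m=0..n l. c m * w * mvar l m)"
    unfolding c(2) by (simp add: sum_distrib_left sum_distrib_right mult_ac)
  then have "f = (\<Sum>m=0..n l. b m * mvar l m)"
    by (simp add: f_eq b_def distrib_right sum.distrib)
  moreover have "b m \<in> point_ideal_deg k n \<X> ?d" if "m \<in> {0..n l}" for m
    unfolding point_ideal_deg_iff[OF dm] b_def
    using forms_mult[of "c m" k n 0 w ?d] c(1) w(1) u[OF that] that
    by (simp add: forms_add ev_add ev_mult ev_w)
  ultimately show ?thesis
    by (auto simp: var_mult_piece_def lookup_add intro!: exI[of _ b])
qed

section \<open>Stabilisation of the Hilbert function and finiteness\<close>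

lemma single_Suc: "Poly_Mapping.single l (Suc i) = Poly_Mapping.single l i + unit_deg l"
  by (simp flip: single_add)

text \<open>The dimension count is used only at \<open>a\<close>; from there on it is surjectivity
  of the multiplication that propagates.\<close>

lemma V_eq_from:
  assumes l: "l \<in> {1..k}"
    and "fun_vs.dim (V (j + Poly_Mapping.single l a)) = fun_vs.dim (V (j + Poly_Mapping.single l (Suc a)))"
    and "a \<le> t"
  shows "V (j + Poly_Mapping.single l t + unit_deg l) = (*) (ev (lin l)) ` V (j + Poly_Mapping.single l t)"
  using assms(3)
proof (induction t rule: dec_induct)
  case base
  show ?case
    using V_eq_if_dim_eq[OF l] assms(2) by (simp only: single_Suc add.assoc)
next
  case (step t)
  then show ?case
    using V_eq_Suc[OF l step.IH] by (simp only: single_Suc add.assoc)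
qed

lemma stable_index:
  assumes l: "l \<in> {1..k}" and j: "j \<in> multidegs ({1..k} - {l})"
  defines "s \<equiv> stable_index k n \<X> l j"
  shows "1 \<le> s" and "s \<le> Suc (card \<X>)"
    and "fun_vs.dim (V (j + Poly_Mapping.single l (s - 1))) = fun_vs.dim (V (j + Poly_Mapping.single l s))"
proof -
  let ?H = "\<lambda>a. fun_vs.dim (V (j + Poly_Mapping.single l a))"
  have "j + Poly_Mapping.single l a \<in> multidegs {1..k}" for a
    using j l Poly_Mapping.keys_add[of j "Poly_Mapping.single l a"]
    by (auto simp: multidegs_def split: if_splits)
  then have s: "s = (LEAST i. 1 \<le> i \<and> ?H (i - 1) = ?H i)"
    by (simp add: s_def stable_index_def hilbert_fun_eq)
  have "\<exists>i. (1 \<le> i \<and> ?H (i - 1) = ?H i) \<and> i \<le> Suc (card \<X>)"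
  proof (rule ccontr)
    assume no: "\<not> ?thesis"
    \<comment> \<open>Without a repetition each step gains at least 1, starting from the trivial
      bound 0. At \<open>Suc (card \<X>)\<close> this exceeds the bound \<open>card \<X>\<close> on
      the dimension.\<close>
    have "a \<le> ?H a" if "a \<le> Suc (card \<X>)" for a
      using that
    proof (induction a)
      case (Suc a)
      have "?H a \<le> ?H (Suc a)"
        using dim_V_mono[OF l, of "j + Poly_Mapping.single l a"] by (simp only: single_Suc add.assoc)
      moreover have "?H a \<noteq> ?H (Suc a)"
        using no Suc.prems by (auto dest: spec[of _ "Suc a"])
      ultimately show ?case
        using Suc by simp
    qed simp
    from this[of "Suc (card \<X>)"] show False
      using dim_V_le[of "j + Poly_Mapping.single l (Suc (card \<X>))"] by simp
  qed
  then obtain i where i: "1 \<le> i \<and> ?H (i - 1) = ?H i" "i \<le> Suc (card \<X>)"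
    by blast
  have "1 \<le> s \<and> ?H (s - 1) = ?H s"
    unfolding s by (rule LeastI[of "\<lambda>i. 1 \<le> i \<and> ?H (i - 1) = ?H i", OF i(1)])
  then show "1 \<le> s" "?H (s - 1) = ?H s"
    by simp_all
  have "s \<le> i"
    unfolding s by (rule Least_le[of "\<lambda>i. 1 \<le> i \<and> ?H (i - 1) = ?H i", OF i(1)])
  then show "s \<le> Suc (card \<X>)"
    using i(2) by simp
qed

text \<open>An entry above \<open>Suc (card \<X>)\<close> exceeds every stable index in its
  direction, which puts the degree into \<open>calA\<close>. What remains lies in a box.\<close>

lemma finite_calE: "finite (calE k n \<X>)"
proof -
  let ?s = "Suc (card \<X>)"
  let ?F = "{f. \<forall>l. (l \<in> {1..k} \<longrightarrow> f l \<in> {0..?s}) \<and> (l \<notin> {1..k} \<longrightarrow> f l = (0::nat))}"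
  have "Poly_Mapping.lookup ` calE k n \<X> \<subseteq> ?F"
  proof safe
    fix i l assume i: "i \<in> calE k n \<X>"
    then have im: "i \<in> multidegs {1..k}"
      by (simp add: calE_def calB_def)
    then show "Poly_Mapping.lookup i l = 0" if "l \<notin> {1..k}"
      using that by (auto simp: multidegs_def in_keys_iff)
    show "Poly_Mapping.lookup i l \<in> {0..?s}" if l: "l \<in> {1..k}"
    proof (rule ccontr)
      assume "Poly_Mapping.lookup i l \<notin> {0..?s}"
      then have big: "?s < Poly_Mapping.lookup i l" by simp
      \<comment> \<open>\<open>j\<close> clears the \<open>l\<close>-th entry; the excess of that
        entry over the stable index is then the \<open>r\<close> of
        \<open>calA_part\<close>.\<close>
      define j where "j = i - Poly_Mapping.single l (Poly_Mapping.lookup i l)"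
      have j: "j \<in> multidegs ({1..k} - {l})"
        using im by (auto simp: multidegs_def j_def in_keys_iff lookup_minus lookup_single when_def
            split: if_splits)
      define t where "t = stable_index k n \<X> l j"
      have t: "t < Poly_Mapping.lookup i l"
        using stable_index(2)[OF l j] big by (simp add: t_def)
      have "i = j + Poly_Mapping.single l t + Poly_Mapping.single l (Poly_Mapping.lookup i l - t)"
        using t by (intro poly_mapping_eqI)
          (auto simp: j_def lookup_add lookup_minus lookup_single when_def)
      then have "i \<in> calA_part k n \<X> l j"
        using t unfolding calA_part_def t_def by fastforce
      then have "i \<in> calA k n \<X>"
        using l j unfolding calA_def by blast
      then show False
        using i by (simp add: calE_def)
    qed
  qed
  moreover have "finite ?F"
    by (rule finite_set_of_finite_funs) auto
  ultimately have "finite (Poly_Mapping.lookup ` calE k n \<X>)"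
    by (rule finite_subset)
  then show ?thesis
  proof (rule finite_imageD)
    show "inj_on Poly_Mapping.lookup (calE k n \<X>)"
      unfolding inj_on_def poly_mapping_eq_iff by blast
  qed
qed

section \<open>Degrees of minimal generators\<close>

lemma zero_in_var_mult_piece:
  assumes "i \<in> multidegs {1..k}"
  shows "0 \<in> var_mult_piece k n \<X> i m"
proof (cases "Poly_Mapping.lookup i m = 0")
  case False
  have "i - unit_deg m \<in> multidegs {1..k}"
    using assms by (auto simp: multidegs_def in_keys_iff lookup_minus)
  then have "0 \<in> point_ideal_deg k n \<X> (i - unit_deg m)"
    by (simp add: point_ideal_deg_iff)
  with False show ?thesis
    by (auto simp: var_mult_piece_def intro!: exI[of _ "\<lambda>_. 0"])
qed (simp add: var_mult_piece_def)

lemma not_generator_if_var_mult_piece: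
  assumes "i \<in> multidegs {1..k}" and l: "l \<in> {1..k}" and f: "f \<in> var_mult_piece k n \<X> i l"
  shows "\<not> is_generator k n \<X> i f"
proof -
  define g where "g = (\<lambda>m. if m = l then f else 0)"
  have "f = (\<Sum>m=1..k. g m)"
    using l by (simp add: g_def)
  moreover have "\<forall>m\<in>{1..k}. g m \<in> var_mult_piece k n \<X> i m"
    using f zero_in_var_mult_piece[OF assms(1)] by (simp add: g_def)
  ultimately show ?thesis
    unfolding is_generator_def by blast
qed

text \<open>The strict inequality in \<open>calB\<close> needs a nonzero form in the kernel of
  evaluation; this makes every generator one.\<close>

lemma not_generator_0: "\<not> is_generator k n \<X> i 0"
proof
  assume gen: "is_generator k n \<X> i 0"
  then have "i \<in> multidegs {1..k}"
    by (simp add: is_generator_def)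
  then have "\<forall>m\<in>{1..k}. 0 \<in> var_mult_piece k n \<X> i m"
    using zero_in_var_mult_piece by blast
  moreover have "(0::'a mpoly) = (\<Sum>m=1..k. (\<lambda>_. 0) m)"
    by simp
  ultimately have "0 \<in> {\<Sum>m=1..k. g m | g. \<forall>m\<in>{1..k}. g m \<in> var_mult_piece k n \<X> i m}"
    by blast
  then show False
    using gen by (simp add: is_generator_def)
qed

text \<open>The kernel vector \<open>f\<close> lowers the dimension, which gives
  \<open>calB\<close>. A degree in \<open>calA\<close> lies two steps above a degree from which
  multiplication by the linear form is onto, and there \<open>f\<close> would come from lower
  degree.\<close>

lemma generator_degree:
  assumes gen: "is_generator k n \<X> i f"
  shows "i \<in> calE k n \<X>"
proof -
  have i: "i \<in> multidegs {1..k}" and f: "f \<in> forms k n i" "ev f = 0"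
    using gen point_ideal_deg_iff by (auto simp: is_generator_def)
  have "f \<noteq> 0"
    using gen not_generator_0 by blast
  moreover obtain T where "finite T" "(forms k n i :: 'a mpoly set) \<subseteq> poly_vs.span T"
    using forms_finitely_spanned by blast
  ultimately have "fun_vs.dim (V i) < poly_vs.dim (forms k n i :: 'a mpoly set)"
    unfolding V_def using f
    by (intro poly_vs.dim_linear_image_less[OF fun_vs.vector_space_axioms linear_ev subspace_forms])
  then have "i \<in> calB k n \<X>"
    using i by (simp add: calB_def hilbert_fun_eq dim_forms)
  moreover have "i \<notin> calA k n \<X>"
  proof
    assume "i \<in> calA k n \<X>"
    then obtain l j r where l: "l \<in> {1..k}" and j: "j \<in> multidegs ({1..k} - {l})" and r: "1 \<le> r"
      and i_eq: "i = j + Poly_Mapping.single l (stable_index k n \<X> l j) + Poly_Mapping.single l r"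
      unfolding calA_def calA_part_def by blast
    obtain a where a: "stable_index k n \<X> l j = Suc a"
      using stable_index(1)[OF l j] by (metis Suc_le_D One_nat_def)
    obtain b where b: "r = Suc b"
      using r by (metis Suc_le_D One_nat_def)
    \<comment> \<open>With stable index \<open>a + 1\<close> and shift \<open>b + 1\<close>, the
      degree is \<open>j + (a + b + 2) e_l\<close>. The dimensions agree at \<open>a\<close> and
      \<open>a + 1\<close>, and surjectivity persists up to \<open>a + b\<close>; the positive shift
      supplies the second \<open>e_l\<close> above \<open>d\<close>.\<close>
    define d where "d = j + Poly_Mapping.single l (a + b)"
    have i_d: "i = d + unit_deg l + unit_deg l"
      unfolding i_eq a b d_def by (simp add: add.assoc flip: single_add)
    have "V (d + unit_deg l) = (*) (ev (lin l)) ` V d"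
      unfolding d_def using stable_index(3)[OF l j] a by (intro V_eq_from[OF l _ le_add1]) simp
    moreover have "d \<in> multidegs {1..k}"
      using j l Poly_Mapping.keys_add[of j "Poly_Mapping.single l (a + b)"]
      by (auto simp: multidegs_def d_def split: if_splits)
    ultimately have "f \<in> var_mult_piece k n \<X> i l"
      using var_mult_piece_if_V_eq[OF l] f unfolding i_d by blast
    then show False
      using not_generator_if_var_mult_piece[OF i l] gen by blast
  qed
  ultimately show ?thesis
    by (simp add: calE_def)
qed

section \<open>Generation of the ideal\<close>

lemma ideal_sum_closed:
  assumes "ideal J R" and "\<And>x. x \<in> A \<Longrightarrow> f x \<in> J"
  shows "(\<Sum>x\<in>A. f x) \<in> J"
proof -
  interpret J: ideal J R by fact
  show ?thesis
    using assms(2)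
    by (induction A rule: infinite_finite_induct)
      (use J.zero_closed J.a_closed in \<open>auto simp: mpoly_ring_simps\<close>)
qed

lemma point_ideal_sum_subset: "point_ideal_sum k n \<X> D \<subseteq> I"
  unfolding point_ideal_sum_def by (auto simp: point_ideal_deg_def intro!: ideal_sum_closed[OF ideal_I])

text \<open>Induction on the total degree: a generator has its degree in \<open>calE\<close>, and
  any other element is a sum of variables times ideal elements whose total degree is smaller by
  1.\<close>

lemma point_ideal_deg_subset:
  assumes "i \<in> multidegs {1..k}"
  shows "point_ideal_deg k n \<X> i \<subseteq> Idl\<^bsub>R\<^esub> (point_ideal_sum k n \<X> (calE k n \<X>))"
    (is "_ \<subseteq> ?J")
  using assms
proof (induction "\<Sum>l\<in>{1..k}. Poly_Mapping.lookup i l" arbitrary: i rule: less_induct)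
  case (less i)
  interpret I: ideal I R by (rule ideal_I)
  have sub: "point_ideal_sum k n \<X> (calE k n \<X>) \<subseteq> carrier R"
    using point_ideal_sum_subset I.a_subset by blast
  interpret J: ideal ?J R
    by (rule R.genideal_ideal[OF sub])
  show ?case
  proof
    fix f assume f: "f \<in> point_ideal_deg k n \<X> i"
    show "f \<in> ?J"
    proof (cases "is_generator k n \<X> i f")
      case True
      then have "i \<in> calE k n \<X>"
        by (rule generator_degree)
      then have "f \<in> point_ideal_sum k n \<X> (calE k n \<X>)"
        using f unfolding point_ideal_sum_def
        by (intro CollectI exI[of _ "{i}"] exI[of _ "\<lambda>_. f"]) simp
      then show ?thesis
        using R.genideal_self[OF sub] by blast
    next
      case False
      then obtain g where g: "f = (\<Sum>m=1..k. g m)" "\<forall>m\<in>{1..k}. g m \<in> var_mult_piece k n \<X> i m"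
        using f less.prems unfolding is_generator_def by blast
      have "g m \<in> ?J" if m: "m \<in> {1..k}" for m
      proof (cases "Poly_Mapping.lookup i m = 0")
        case True
        then show ?thesis
          using bspec[OF g(2) m] J.zero_closed by (simp add: var_mult_piece_def mpoly_ring_simps)
      next
        case False
        then obtain c where c: "g m = (\<Sum>h=0..n m. c h * mvar m h)"
          "\<forall>h\<in>{0..n m}. c h \<in> point_ideal_deg k n \<X> (i - unit_deg m)"
          using bspec[OF g(2) m] by (auto simp: var_mult_piece_def)
        have "i - unit_deg m \<in> multidegs {1..k}"
          using less.prems by (auto simp: multidegs_def in_keys_iff lookup_minus)
        moreover have "(\<Sum>l\<in>{1..k}. Poly_Mapping.lookup (i - unit_deg m) l) < (\<Sum>l\<in>{1..k}. Poly_Mapping.lookup i l)"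
          using m False by (intro sum_strict_mono_ex1) (auto simp: lookup_minus lookup_single intro!: bexI[of _ m])
        ultimately have IH: "point_ideal_deg k n \<X> (i - unit_deg m) \<subseteq> ?J"
          by (intro less.hyps)
        have "c h * mvar m h \<in> ?J" if h: "h \<in> {0..n m}" for h
        proof -
          have "mvar m h \<in> carrier R"
            using m h by (intro subsetD[OF forms_subset_carrier mvar_in_forms]) (auto simp: mvars_def)
          moreover have "c h \<in> ?J"
            using IH c(2) h by blast
          ultimately show ?thesis
            using J.I_r_closed[of "c h" "mvar m h"] by (simp add: mpoly_ring_simps)
        qed
        then show ?thesis
          unfolding c(1) by (intro ideal_sum_closed[OF J.is_ideal])
      qed
      then show ?thesis
        unfolding g(1) by (intro ideal_sum_closed[OF J.is_ideal])
    qed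
  qed
qed

text \<open>Since \<open>I\<close> is generated by forms, the degreewise inclusion is enough for the
  nontrivial direction.\<close>

lemma point_ideal_eq: "I = Idl\<^bsub>R\<^esub> (point_ideal_sum k n \<X> (calE k n \<X>))" (is "_ = ?J")
proof
  interpret I: ideal I R by (rule ideal_I)
  have sub: "point_ideal_sum k n \<X> (calE k n \<X>) \<subseteq> carrier R"
    using point_ideal_sum_subset I.a_subset by blast
  show "?J \<subseteq> I"
    by (rule R.genideal_minimal[OF ideal_I point_ideal_sum_subset])
  have "{p. \<exists>i\<in>multidegs {1..k}. p \<in> forms k n i \<and> (\<forall>P\<in>\<X>. vanishes_at k p P)} \<subseteq> ?J"
  proof safe
    fix p i assume i: "i \<in> multidegs {1..k}" and p: "p \<in> forms k n i" "\<forall>P\<in>\<X>. vanishes_at k p P"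
    have "p \<in> point_ideal_deg k n \<X> i"
      unfolding point_ideal_deg_iff[OF i] ev_eq_0_iff using p vanishes_at_iff[OF p(1)] by simp
    then show "p \<in> ?J"
      using point_ideal_deg_subset[OF i] by blast
  qed
  then show "I \<subseteq> ?J"
    unfolding point_ideal_def[of k n \<X>] by (rule R.genideal_minimal[OF R.genideal_ideal[OF sub]])
qed

end

theorem theorem2p2:
  fixes k :: nat
    and n :: "nat \<Rightarrow> nat"
    and \<X> :: "(nat \<Rightarrow> (nat \<Rightarrow> 'a::{field_char_0, alg_closed_field}) set) set"
  assumes "1 \<le> k"
    and "\<forall>l\<in>{1..k}. 1 \<le> n l"
    and "\<X> \<subseteq> multiproj_space k n"
    and "finite \<X>"
    and "\<X> \<noteq> {}"
  shows "finite (calE k n \<X>)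
    \<and> (\<forall>j f. is_generator k n \<X> j f \<longrightarrow> j \<in> calE k n \<X>)
    \<and> point_ideal k n \<X> = Idl\<^bsub>mpoly_ring k n\<^esub> (point_ideal_sum k n \<X> (calE k n \<X>))"
proof -
  interpret multiproj_points k n \<X>
    using assms(3-5) by unfold_locales
  show ?thesis
    using finite_calE generator_degree point_ideal_eq by blast
qed

end
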